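(* Let $\mathcal{A}$ be an abstract continued fraction and let $\{I_i\}_{0\le i<n}$ be unimodular intervals, one for each node. Then the graph-directed iterated function system $(\mathcal{G}_{\mathcal{A}},\{B_a\}_{a\in\mathcal{A}})$ satisfies the Open Set Condition, and all sets $H_0,\ldots,H_{n-1}$ in the attractor are regular (i.e., each one is the closure of its interior). In particular each $H_i$ contains intervals, and the Open Set Condition is satisfied by taking as open sets the interiors of the various $H_i$.
   Context: **Codes.** $\Sigma$ is the monoid generated by $l,n,f$ modulo $fl=nf$, $fn=lf$, $ff=\epsilon$ (identity). Every $\sigma\in\Sigma$ is uniquely a free word $w$ in $l,n$, possibly followed by a single $f$; $\ell(\sigma)$ is the length of $w$. Given nodes $\{0,\ldots,n-1\}$, $n\ge1$ (the integer $n$ is not to be confused with the letter $n$), let $\widetilde\Sigma=\{i\sigma j:\sigma\in\Sigma,\ i,j \text{ nodes}\}$ with partial product $(i\sigma j)(j\tau k)=i\sigma\tau k$ (undefined when the inner nodes differ) and $\ell(i\sigma j)=\ell(\sigma)$. A code is a subset $\mathcal{A}\subset\widetilde\Sigma$ such that whenever two products $a_1\cdots a_r$ and $b_1\cdots b_s$ of elements of $\mathcal{A}$ are defined and equal in $\widetilde\Sigma$, then $r=s$ and $a_k=b_k$ for all $k$. For finite $\mathcal{A}$, $\mathcal{G}_{\mathcal{A}}$ is the directed graph on the nodes whose set of edges from $i$ to $j$ is $E_{ij}=\{\text{elements of }\mathcal{A}\text{ of the form }i\sigma j\}$; $E_i^\omega$ is the set of infinite paths starting at $i$. $G_{\mathcal{A}}$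 is the $n\times n$ matrix with $ij$-entry $\sum_{a\in E_{ij}}2^{-\ell(a)}$. An abstract continued fraction is a finite code $\mathcal{A}$ with $\mathcal{G}_{\mathcal{A}}$ strongly connected and $G_{\mathcal{A}}$ of spectral radius $1$. **Intervals and maps.** Matrices act on $\mathrm{P}^1\mathbb{R}=\mathbb{R}\cup\{\infty\}$ by Möbius maps; $\mathrm{PSL}_2^\pm\mathbb{Z}$ is the group of integer $2\times2$ matrices of determinant $\pm1$ modulo $\pm1$. $\mathrm{Proj}:\Sigma\to\mathrm{PSL}^\pm_2\mathbb{Z}$ is the monoid homomorphism with $l\mapsto\begin{bmatrix}1&0\\1&1\end{bmatrix}$, $n\mapsto\begin{bmatrix}1&1\\0&1\end{bmatrix}$, $f\mapsto\begin{bmatrix}0&1\\1&0\end{bmatrix}$. Unimodular intervals are the images of $[0,\infty]$ under elements of $\mathrm{PSL}_2\mathbb{Z}$; the matrix $\begin{bmatrix}p'&p\\ q'&q\end{bmatrix}$ corresponds bijectively to the closed interval $[p/q,p'/q']$ going counterclockwise (in the increasing direction, possibly through $\infty$) from $p/q$ to $p'/q'$; the same letter denotes interval and matrix. For $a=i\sigma j\in\mathcal{A}$ put $B_a=I_i\,\mathrm{Proj}(\sigma)I_j^{-1}$, which maps $I_j$ into $I_i$; $B_{a_0\ldots a_{t-1}}=B_{a_0}\cdots B_{a_{t-1}}$. The graph $\mathcal{G}_{\mathcal{A}}$ with the maps $\{B_a\}_{a\in\mathcal{A}}$ is the graph-directed IFS; the $I_i$ are thought of as lying in pairwise disjoint copies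 of $\mathrm{P}^1\mathbb{R}$. **Attractor.** For $\mathbf{a}=a_0a_1\ldots\in E_{i_0}^\omega$ with $a_t=i_t\sigma_ti_{t+1}$, $\pi(\mathbf{a})$ is the unique point of $\bigcap_{t\ge0}B_{a_0\ldots a_{t-1}}I_{i_t}$, and $H_i=\pi[E_i^\omega]\subseteq I_i$; the attractor is the disjoint union of the $H_i$. **Open Set Condition.** There exist nonempty sets $U_i\subseteq I_i$ ($0\le i<n$), open in $\mathrm{P}^1\mathbb{R}$, such that for every $i$ the images $B_{i\sigma j}[U_j]$, for $i\sigma j$ ranging over the elements of $\mathcal{A}$ starting at $i$, are pairwise disjoint subsets of $U_i$. Interiors and closures refer to the topology of $\mathrm{P}^1\mathbb{R}$; "intervals" means nondegenerate intervals. *)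

theory Defs
  imports "HOL-Analysis.Analysis" "Graph_Theory.Digraph_Component"
    "Jordan_Normal_Form.Spectral_Radius"
begin

no_notation Matrix.vec_index (infixl \<open>$\<close> 100)

section \<open>The monoid of words in l, n, f\<close>

datatype letter = LetL | LetN | LetF

inductive word_eq :: "letter list \<Rightarrow> letter list \<Rightarrow> bool" where
  fl: "word_eq [LetF, LetL] [LetN, LetF]"
| fn: "word_eq [LetF, LetN] [LetL, LetF]"
| ff: "word_eq [LetF, LetF] []"
| refl: "word_eq u u"
| sym: "word_eq u v \<Longrightarrow> word_eq v u"
| trans: "word_eq u v \<Longrightarrow> word_eq v w \<Longrightarrow> word_eq u w"
| ctxt: "word_eq u v \<Longrightarrow> word_eq (x @ u @ y) (x @ v @ y)"

lemma word_eq_append: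
  assumes "word_eq u u'" "word_eq v v'"
  shows "word_eq (u @ v) (u' @ v')"
  using word_eq.ctxt[OF assms(1), of "[]" v] word_eq.ctxt[OF assms(2), of u' "[]"]
  by (auto intro: word_eq.trans)

quotient_type sig = "letter list" / word_eq
  morphisms rep_sig of_word
  by (intro equivpI reflpI sympI transpI) (blast intro: word_eq.intros)+

instantiation sig :: monoid_mult
begin

lift_definition one_sig :: sig is "[]" .

lift_definition times_sig :: "sig \<Rightarrow> sig \<Rightarrow> sig" is "(@)"
  by (rule word_eq_append)

instance
  by standard (transfer, simp add: word_eq.refl)+

end

lemma of_word_append: "of_word (u @ v) = of_word u * of_word v"
  by (simp add: times_sig.abs_eq)

lemma of_word_Cons: "of_word (x # u) = of_word [x] * of_word u"
  by (simp add: of_word_append[symmetric])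

lemma of_word_Nil: "of_word [] = 1"
  by (simp add: one_sig.abs_eq)

lemma of_word_relations:
  "of_word [LetF] * of_word [LetL] = of_word [LetN] * of_word [LetF]"
  "of_word [LetF] * of_word [LetN] = of_word [LetL] * of_word [LetF]"
  "of_word [LetF] * of_word [LetF] = 1"
  by (simp_all add: of_word_Nil[symmetric] of_word_append[symmetric] sig.abs_eq_iff
      word_eq.fl word_eq.fn word_eq.ff)

definition sig_len :: "sig \<Rightarrow> nat" where
  "sig_len s = length (THE w. set w \<subseteq> {LetL, LetN} \<and>
     (s = of_word w \<or> s = of_word w * of_word [LetF]))"

text \<open>Existence and uniqueness of the normal form, which make \<^const>\<open>sig_len\<close> meaningful:
  the function below moves all the letters f to the right.\<close>

fun push :: "bool \<Rightarrow> letter list \<Rightarrow> letter list \<times> bool" where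
  "push p [] = ([], p)"
| "push p (LetF # u) = push (\<not> p) u"
| "push p (LetL # u) = (let (w, q) = push p u in ((if p then LetN else LetL) # w, q))"
| "push p (LetN # u) = (let (w, q) = push p u in ((if p then LetL else LetN) # w, q))"

lemma push_append:
  "push p (u @ v) = (fst (push p u) @ fst (push (snd (push p u)) v), snd (push (snd (push p u)) v))"
  by (induction p u rule: push.induct) (auto split: prod.splits)

lemma push_word_eq: "word_eq u v \<Longrightarrow> push p u = push p v"
proof (induction arbitrary: p rule: word_eq.induct)
  case (ctxt u v x y)
  then show ?case by (simp add: push_append)
qed auto

lemma push_normal: "set w \<subseteq> {LetL, LetN} \<Longrightarrow> push False w = (w, False)"
  by (induction w) auto

lemma set_push: "set (fst (push p u)) \<subseteq> {LetL, LetN}"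
  by (induction p u rule: push.induct) (auto split: prod.splits)

lemma length_push: "length (fst (push p u)) = length (filter (\<lambda>x. x \<noteq> LetF) u)"
  by (induction p u rule: push.induct) (auto split: prod.splits)

lemma of_word_push:
  "(if p then of_word [LetF] else 1) * of_word u =
   of_word (fst (push p u)) * (if snd (push p u) then of_word [LetF] else 1)"
proof (induction p u rule: push.induct)
  case (1 p)
  then show ?case by (simp add: of_word_Nil)
next
  case (2 p u)
  then show ?case
    by (cases p) (simp_all add: of_word_Cons[of _ u] of_word_relations mult.assoc[symmetric])
next
  case (3 p u)
  obtain w e where "push p u = (w, e)"
    by fastforce
  with 3 show ?case
    by (cases p) (simp_all add: of_word_Cons[of _ u] of_word_Cons[of _ w] of_word_relations
      mult.assoc[symmetric], simp_all add: mult.assoc)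
next
  case (4 p u)
  obtain w e where "push p u = (w, e)"
    by fastforce
  with 4 show ?case
    by (cases p) (simp_all add: of_word_Cons[of _ u] of_word_Cons[of _ w] of_word_relations
      mult.assoc[symmetric], simp_all add: mult.assoc)
qed

lemma normal_form:
  "\<exists>!(w, e). set w \<subseteq> {LetL, LetN} \<and> s = of_word w * (if e then of_word [LetF] else 1)"
proof -
  obtain u where u: "s = of_word u"
    by (induction s rule: sig.abs_induct) blast
  have "push False u = (w, e)"
    if "set w \<subseteq> {LetL, LetN}" "s = of_word w * (if e then of_word [LetF] else 1)" for w e
  proof -
    have "word_eq u (w @ (if e then [LetF] else []))"
      using that u by (cases e) (simp_all add: of_word_append[symmetric] sig.abs_eq_iff[symmetric])
    from push_word_eq[OF this, of False] show ?thesis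
      using that(1) by (cases e) (simp_all add: push_append push_normal)
  qed
  moreover have "s = of_word (fst (push False u)) * (if snd (push False u) then of_word [LetF] else 1)"
    using of_word_push[of False u] u by simp
  ultimately show ?thesis
    using set_push[of False u] unfolding Ex1_def case_prod_unfold by (metis prod.collapse)
qed

lemma sig_len_of_word: "sig_len (of_word u) = length (filter (\<lambda>x. x \<noteq> LetF) u)"
proof -
  have "(THE w. set w \<subseteq> {LetL, LetN} \<and>
     (of_word u = of_word w \<or> of_word u = of_word w * of_word [LetF])) = fst (push False u)"
  proof (rule the_equality)
    show "set (fst (push False u)) \<subseteq> {LetL, LetN} \<and> (of_word u = of_word (fst (push False u)) \<or>
      of_word u = of_word (fst (push False u)) * of_word [LetF])"
      using of_word_push[of False u] set_push[of False u] by (simp split: if_splits)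
  next
    fix w assume w: "set w \<subseteq> {LetL, LetN} \<and>
      (of_word u = of_word w \<or> of_word u = of_word w * of_word [LetF])"
    then have "word_eq u w \<or> word_eq u (w @ [LetF])"
      by (simp add: of_word_append[symmetric] sig.abs_eq_iff)
    then show "w = fst (push False u)"
      using w push_word_eq[of u _ False] by (auto simp: push_append push_normal)
  qed
  then show ?thesis
    by (simp add: sig_len_def length_push)
qed

section \<open>Codes and abstract continued fractions\<close>

text \<open>The triple \<open>(i, s, j)\<close> stands for the element $i \sigma j$.\<close>

type_synonym edge = "nat \<times> sig \<times> nat"

definition src :: "edge \<Rightarrow> nat" where "src a = fst a"
definition lab :: "edge \<Rightarrow> sig" where "lab a = fst (snd a)"
definition tgt :: "edge \<Rightarrow> nat" where "tgt a = snd (snd a)"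

definition sig_tilde :: "nat \<Rightarrow> edge set" where
  "sig_tilde n = {(i, s, j) | i s j. i < n \<and> j < n}"

definition edge_mult :: "edge \<Rightarrow> edge \<Rightarrow> edge option" where
  "edge_mult a b = (if tgt a = src b then Some (src a, lab a * lab b, tgt b) else None)"

text \<open>\<^const>\<open>None\<close> means undefined. The product of the empty list is undefined, as there is
  no neutral element common to all nodes.\<close>

fun edge_prod :: "edge list \<Rightarrow> edge option" where
  "edge_prod [] = None"
| "edge_prod [a] = Some a"
| "edge_prod (a # b # as) = Option.bind (edge_prod (b # as)) (edge_mult a)"

definition is_code :: "nat \<Rightarrow> edge set \<Rightarrow> bool" where
  "is_code n A \<longleftrightarrow> A \<subseteq> sig_tilde n \<and>
     (\<forall>as bs. set as \<subseteq> A \<and> set bs \<subseteq> A \<and> edge_prod as \<noteq> None \<and> edge_prod as = edge_prod bs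
        \<longrightarrow> as = bs)"

definition code_graph :: "nat \<Rightarrow> edge set \<Rightarrow> (nat, edge) pre_digraph" where
  "code_graph n A = \<lparr> verts = {..<n}, arcs = A, tail = src, head = tgt \<rparr>"

definition edges_between :: "edge set \<Rightarrow> nat \<Rightarrow> nat \<Rightarrow> edge set" where
  "edges_between A i j = {a \<in> A. src a = i \<and> tgt a = j}"

definition code_matrix :: "nat \<Rightarrow> edge set \<Rightarrow> complex Matrix.mat" where
  "code_matrix n A = Matrix.mat n n (\<lambda>(i, j). \<Sum>a \<in> edges_between A i j. 1 / 2 ^ sig_len (lab a))"

definition abstract_cf :: "nat \<Rightarrow> edge set \<Rightarrow> bool" where
  "abstract_cf n A \<longleftrightarrow> finite A \<and> is_code n A \<and> strongly_connected (code_graph n A) \<and>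
     spectral_radius (code_matrix n A) = 1"

definition inf_paths :: "edge set \<Rightarrow> nat \<Rightarrow> (nat \<Rightarrow> edge) set" where
  "inf_paths A i = {p. (\<forall>t. p t \<in> A) \<and> src (p 0) = i \<and> (\<forall>t. tgt (p t) = src (p (Suc t)))}"

section \<open>The projective line and unimodular intervals\<close>

text \<open>\<^const>\<open>None\<close> is the point at infinity.\<close>

type_synonym p1 = "real option"

definition p1_top :: "p1 topology" where
  "p1_top = Alexandroff_compactification euclideanreal"

text \<open>An element of $\mathrm{PSL}_2^\pm\mathbb{Z}$ is given by either of its two representing
  matrices; the statement uses matrices only through their action \<open>mobius\<close>, which does not
  depend on the choice of the sign (lemma \<open>mobius_uminus\<close>).\<close>

definition mat2 :: "int \<Rightarrow> int \<Rightarrow> int \<Rightarrow> int \<Rightarrow> int^2^2" where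
  "mat2 a b c d = vector [vector [a, b], vector [c, d]]"

definition mobius :: "int^2^2 \<Rightarrow> p1 \<Rightarrow> p1" where
  "mobius M x =
     (let a = real_of_int (M $ 1 $ 1); b = real_of_int (M $ 1 $ 2);
          c = real_of_int (M $ 2 $ 1); d = real_of_int (M $ 2 $ 2)
      in case x of
           None \<Rightarrow> if c = 0 then None else Some (a / c)
         | Some t \<Rightarrow> if c * t + d = 0 then None else Some ((a * t + b) / (c * t + d)))"

lemma mat2_nth [simp]:
  "mat2 a b c d $ 1 $ 1 = a" "mat2 a b c d $ 1 $ 2 = b"
  "mat2 a b c d $ 2 $ 1 = c" "mat2 a b c d $ 2 $ 2 = d"
  by (simp_all add: mat2_def)

lemma mat2_eqI:
  assumes "M $ 1 $ 1 = a" "M $ 1 $ 2 = b" "M $ 2 $ 1 = c" "M $ 2 $ 2 = d"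
  shows "M = mat2 a b c d"
proof -
  have "M $ i $ j = mat2 a b c d $ i $ j" for i j
    using exhaust_2[of i] exhaust_2[of j] assms by (elim disjE) (simp_all only: mat2_nth)
  then show ?thesis by (simp only: Finite_Cartesian_Product.vec_eq_iff simp_thms)
qed

lemma matrix_mult_nth2:
  fixes A B :: "int^2^2"
  shows "(A ** B) $ i $ j = A $ i $ 1 * B $ 1 $ j + A $ i $ 2 * B $ 2 $ j"
  by (simp only: matrix_matrix_mult_def sum_2 vec_lambda_beta)

lemma mat2_mult:
  "mat2 a b c d ** mat2 a' b' c' d' =
   mat2 (a * a' + b * c') (a * b' + b * d') (c * a' + d * c') (c * b' + d * d')"
  by (rule mat2_eqI) (simp_all only: matrix_mult_nth2 mat2_nth)

lemma mat2_one: "Finite_Cartesian_Product.mat 1 = mat2 1 0 0 1"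
  by (rule mat2_eqI) (simp_all add: Finite_Cartesian_Product.mat_def)

lemma mobius_uminus: "mobius (- M) = mobius M"
proof
  fix x
  have 1: "(- (a * t) - b) / (- (c * t) - d) = (a * t + b) / (c * t + d)" for a b c d t :: real
    using minus_divide_divide[of "a * t + b" "c * t + d"] by (simp del: minus_divide_divide)
  have 2: "- (c * t) - d = 0 \<longleftrightarrow> c * t + d = 0" for c d t :: real
    by linarith
  show "mobius (- M) x = mobius M x"
    using 1 2 by (cases x) (simp_all only: mobius_def Let_def option.case vector_uminus_component
      of_int_minus mult_minus_left diff_conv_add_uminus[symmetric] neg_equal_0_iff_equal
      minus_divide_divide)
qed

text \<open>The three generators satisfy the relations of the monoid already as matrices, so that
  \<open>Proj\<close> can be defined with values in matrices of determinant $\pm 1$.\<close>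

primrec letter_mat :: "letter \<Rightarrow> int^2^2" where
  "letter_mat LetL = mat2 1 0 1 1"
| "letter_mat LetN = mat2 1 1 0 1"
| "letter_mat LetF = mat2 0 1 1 0"

primrec word_mat :: "letter list \<Rightarrow> int^2^2" where
  "word_mat [] = Finite_Cartesian_Product.mat 1"
| "word_mat (x # u) = letter_mat x ** word_mat u"

lemma word_mat_append: "word_mat (u @ v) = word_mat u ** word_mat v"
proof (induction u)
  case Nil
  show ?case by (simp only: append_Nil word_mat.simps matrix_mul_lid)
next
  case (Cons x u)
  then show ?case by (simp only: append_Cons word_mat.simps matrix_mul_assoc)
qed

lift_definition Proj :: "sig \<Rightarrow> int^2^2" is word_mat
proof -
  fix u v assume "word_eq u v"
  then show "word_mat u = word_mat v"
  proof induction
    case (ctxt u v x y)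
    then show ?case by (simp only: word_mat_append)
  qed (simp_all only: word_mat.simps letter_mat.simps mat2_mult mat2_one, simp_all)
qed

lemma Proj_one: "Proj 1 = Finite_Cartesian_Product.mat 1"
  by transfer (simp only: word_mat.simps matrix_mul_rid)

lemma Proj_mult: "Proj (s * t) = Proj s ** Proj t"
  by transfer (rule word_mat_append)

lemma Proj_of_word: "Proj (of_word [x]) = letter_mat x"
  by transfer (simp only: word_mat.simps matrix_mul_rid)

text \<open>An integer matrix $M$ of determinant $1$ with rows $(p', p)$ and $(q', q)$ maps $0$ to
  $p/q$ and $\infty$ to $p'/q'$, so the image below is the interval that corresponds to $M$.\<close>

definition uni_interval :: "int^2^2 \<Rightarrow> p1 set" where
  "uni_interval M = mobius M ` insert None (Some ` {0..})"

text \<open>The closed interval from \<open>x\<close> counterclockwise to \<open>y\<close>, for \<open>x \<noteq> y\<close>.\<close>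

fun p1_interval :: "p1 \<Rightarrow> p1 \<Rightarrow> p1 set" where
  "p1_interval (Some x) (Some y) =
     (if x < y then Some ` {x..y} else insert None (Some ` ({x..} \<union> {..y})))"
| "p1_interval (Some x) None = insert None (Some ` {x..})"
| "p1_interval None (Some y) = insert None (Some ` {..y})"
| "p1_interval None None = {None}"

section \<open>The graph-directed iterated function system and its attractor\<close>

definition edge_mat :: "(nat \<Rightarrow> int^2^2) \<Rightarrow> edge \<Rightarrow> int^2^2" where
  "edge_mat I a = I (src a) ** Proj (lab a) ** matrix_inv (I (tgt a))"

primrec path_mat :: "(nat \<Rightarrow> int^2^2) \<Rightarrow> (nat \<Rightarrow> edge) \<Rightarrow> nat \<Rightarrow> int^2^2" where
  "path_mat I p 0 = Finite_Cartesian_Product.mat 1"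
| "path_mat I p (Suc t) = path_mat I p t ** edge_mat I (p t)"

definition path_point :: "(nat \<Rightarrow> int^2^2) \<Rightarrow> (nat \<Rightarrow> edge) \<Rightarrow> p1" where
  "path_point I p =
     (THE x. x \<in> (\<Inter>t. mobius (path_mat I p t) ` uni_interval (I (src (p t)))))"

text \<open>The component at the node \<open>i\<close> of the attractor; the disjoint union is rendered by
  the index \<open>i\<close>.\<close>

definition attractor :: "edge set \<Rightarrow> (nat \<Rightarrow> int^2^2) \<Rightarrow> nat \<Rightarrow> p1 set" where
  "attractor A I i = path_point I ` inf_paths A i"

definition osc_witness ::
  "nat \<Rightarrow> edge set \<Rightarrow> (nat \<Rightarrow> int^2^2) \<Rightarrow> (nat \<Rightarrow> p1 set) \<Rightarrow> bool" where
  "osc_witness n A I U \<longleftrightarrow>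
     (\<forall>i<n. U i \<noteq> {} \<and> U i \<subseteq> uni_interval (I i) \<and> openin p1_top (U i)) \<and>
     (\<forall>i<n. (\<forall>a\<in>A. src a = i \<longrightarrow> mobius (edge_mat I a) ` U (tgt a) \<subseteq> U i) \<and>
            disjoint_family_on (\<lambda>a. mobius (edge_mat I a) ` U (tgt a)) {a \<in> A. src a = i})"

definition open_set_condition :: "nat \<Rightarrow> edge set \<Rightarrow> (nat \<Rightarrow> int^2^2) \<Rightarrow> bool" where
  "open_set_condition n A I \<longleftrightarrow> (\<exists>U. osc_witness n A I U)"

end

theory Submission
  imports Defs
begin

text \<open>All maps of the system are conjugate, node by node, to the action of the labels on the positive
  half-line: the matrices of the intervals telescope along a walk. It therefore suffices to treat the
  limit sets \<open>limit_set i\<close> of the points coded by infinite walks in the half-line. A label with normal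
  form w, possibly followed by the inversion, maps the half-line onto the cell of w, a Farey interval;
  the cells of level m tile the half-line and become small as m grows. This makes the half-line a
  coarse version of the Cantor space of words in l and n, on which a label of length k contracts the
  fair coin measure by exactly the factor 1 / 2 ^ k. The code property says that a walk from a given
  node is determined by its label and its end node, so that only boundedly many walks can cross one
  level inside one cell, each in one of finitely many ways (\<open>inj_on_overhang\<close>).

  Interior: the moduli of an eigenvector for an eigenvalue of modulus one form a nonzero subinvariant
  vector of the matrix of the code (\<open>spectral_radius_one_imp_subinvariant\<close>). Weighted with it, the
  walks that cross a level inside a cell give that cell a density. By subinvariance the density of a cell
  is at most the mean of the densities of its two halves (\<open>cyl_density_le_mean\<close>), and by the code
  property it takes only finitely many values. Where it is maximal it is thus maximal on all subcells,
  and in particular positive; all subcells are crossed by walks, and a whole cell lies in the limit set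
  (\<open>limit_set_contains_cell\<close>). Strong connectivity carries a copy of this cell into every limit set, and
  self-similarity places further copies arbitrarily close to every point (\<open>limit_set_regular\<close>).

  Disjointness: an irrational point has a unique expansion in l and n, so the code property bounds the
  number of infinite walks that code it (\<open>card_codings_le\<close>). Choose a node and a cell over which all
  irrational points have at least M codings, with M as large as possible. If the images under two edges
  a and b overlapped in an open set, a copy of that cell could be moved into the overlap along a walk
  that begins with a, and each of its irrational points would have M codings that begin with a and
  another one that begins with b (\<open>edge_images_disjoint\<close>).\<close>

section \<open>Homogeneous coordinates on the projective line\<close>

definition hom_pt :: "real \<times> real \<Rightarrow> p1" where
  "hom_pt v = (if snd v = 0 then None else Some (fst v / snd v))"

definition mat_act :: "int^2^2 \<Rightarrow> real \<times> real \<Rightarrow> real \<times> real" where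
  "mat_act M v = (real_of_int (M $ 1 $ 1) * fst v + real_of_int (M $ 1 $ 2) * snd v,
                  real_of_int (M $ 2 $ 1) * fst v + real_of_int (M $ 2 $ 2) * snd v)"

lemma hom_pt_surj: "\<exists>v. v \<noteq> 0 \<and> x = hom_pt v"
proof (cases x)
  case None
  then show ?thesis by (intro exI[of _ "(1, 0)"]) (simp add: hom_pt_def zero_prod_def)
next
  case (Some t)
  then show ?thesis by (intro exI[of _ "(t, 1)"]) (simp add: hom_pt_def zero_prod_def)
qed

lemma mobius_hom_pt:
  assumes "v \<noteq> 0"
  shows "mobius M (hom_pt v) = hom_pt (mat_act M v)"
proof -
  obtain x y where v: "v = (x, y)" by fastforce
  show ?thesis
  proof (cases "y = 0")
    case True
    then have "x \<noteq> 0" using assms v by (auto simp: zero_prod_def)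
    then show ?thesis using True v by (auto simp: mobius_def hom_pt_def mat_act_def)
  next
    case False
    have e: "c * (x / y) + d = (c * x + d * y) / y" for c d :: real
      using False by (simp add: field_simps)
    show ?thesis using False v by (simp add: mobius_def hom_pt_def mat_act_def Let_def e del: times_divide_eq_right)
  qed
qed

lemma det_2x2_int: "Determinants.det (M :: int^2^2) = M $ 1 $ 1 * M $ 2 $ 2 - M $ 1 $ 2 * M $ 2 $ 1"
  by (rule det_2)

lemma mat_act_nonzero:
  assumes "Determinants.det M \<noteq> 0" "v \<noteq> 0"
  shows "mat_act M v \<noteq> 0"
proof
  assume z: "mat_act M v = 0"
  obtain x y where v: "v = (x, y)" by fastforce
  define a b c d where "a = real_of_int (M $ 1 $ 1)" and "b = real_of_int (M $ 1 $ 2)"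
    and "c = real_of_int (M $ 2 $ 1)" and "d = real_of_int (M $ 2 $ 2)"
  have 0: "a * x + b * y = 0" "c * x + d * y = 0"
    using z v by (auto simp: mat_act_def a_def b_def c_def d_def zero_prod_def)
  have "(a * d - b * c) * x = d * (a * x + b * y) - b * (c * x + d * y)"
    "(a * d - b * c) * y = a * (c * x + d * y) - c * (a * x + b * y)"
    by (simp_all add: algebra_simps)
  then have "(a * d - b * c) * x = 0" "(a * d - b * c) * y = 0"
    using 0 by simp_all
  moreover have "a * d - b * c = real_of_int (Determinants.det M)"
    by (simp only: of_int_diff of_int_mult det_2x2_int a_def b_def c_def d_def)
  ultimately show False using assms v by (auto simp: zero_prod_def)
qed

lemma mat_act_mult: "mat_act (M ** N) v = mat_act M (mat_act N v)"
  by (simp only: mat_act_def matrix_mult_nth2 fst_conv snd_conv of_int_add of_int_mult prod.inject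
      distrib_left distrib_right mult.assoc add.assoc add.left_commute simp_thms)

lemma mobius_mult:
  assumes "Determinants.det N \<noteq> 0"
  shows "mobius (M ** N) x = mobius M (mobius N x)"
proof -
  obtain v where v: "v \<noteq> 0" "x = hom_pt v" using hom_pt_surj by blast
  then show ?thesis
    by (simp add: mobius_hom_pt mat_act_nonzero[OF assms] mat_act_mult)
qed

lemma mobius_one: "mobius (Finite_Cartesian_Product.mat 1) x = x"
  by (cases x) (simp_all add: mobius_def mat2_one)

lemma det_square_one_imp_inverse:
  assumes "(Determinants.det (M :: int^2^2))\<^sup>2 = 1"
  obtains N where "M ** N = Finite_Cartesian_Product.mat 1" "N ** M = Finite_Cartesian_Product.mat 1"
    "(Determinants.det N)\<^sup>2 = 1"
proof -
  define e where "e = Determinants.det M"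
  have e: "e * e = 1" using assms by (simp add: e_def power2_eq_square)
  define a b c d where "a = M $ 1 $ 1" and "b = M $ 1 $ 2" and "c = M $ 2 $ 1" and "d = M $ 2 $ 2"
  have M: "M = mat2 a b c d" by (rule mat2_eqI) (simp_all only: a_def b_def c_def d_def)
  have ed: "e = a * d - b * c" by (simp only: e_def det_2x2_int a_def b_def c_def d_def)
  define N where "N = mat2 (e * d) (- e * b) (- e * c) (e * a)"
  have "M ** N = Finite_Cartesian_Product.mat 1" "N ** M = Finite_Cartesian_Product.mat 1"
  proof -
    have 1: "a * (e * d) + b * (- e * c) = 1" "c * (- e * b) + d * (e * a) = 1"
      "e * d * a + - e * b * c = 1" "- e * c * b + e * a * d = 1"
    proof -
      have "e * (a * d - b * c) = 1" using e ed by simp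
      then show "a * (e * d) + b * (- e * c) = 1" "c * (- e * b) + d * (e * a) = 1"
        "e * d * a + - e * b * c = 1" "- e * c * b + e * a * d = 1"
        by (simp_all only: right_diff_distrib) (simp_all add: mult_ac)
    qed
    have 2: "a * (- e * b) + b * (e * a) = 0" "c * (e * d) + d * (- e * c) = 0"
      "e * d * b + - e * b * d = 0" "- e * c * a + e * a * c = 0"
      by simp_all
    show "M ** N = Finite_Cartesian_Product.mat 1" "N ** M = Finite_Cartesian_Product.mat 1"
      unfolding M N_def mat2_mult mat2_one 1 2 by simp_all
  qed
  moreover from this have "Determinants.det M * Determinants.det N = 1"
    by (metis det_I det_mul)
  then have "(Determinants.det M)\<^sup>2 * (Determinants.det N)\<^sup>2 = 1"
    by (metis power_mult_distrib power_one)
  then have "(Determinants.det N)\<^sup>2 = 1"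
    using assms by simp
  ultimately show thesis using that by blast
qed

lemma open_mat_act_vimage: "open V \<Longrightarrow> open (mat_act M -` V)"
  unfolding mat_act_def by (intro open_vimage continuous_intros)

lemma openin_p1_top_iff:
  "openin p1_top U \<longleftrightarrow> open (Some -` U) \<and> (None \<in> U \<longrightarrow> (\<exists>R. \<forall>t. \<bar>t\<bar> > R \<longrightarrow> Some t \<in> U))"
proof
  assume "openin p1_top U"
  then consider V where "open V" "U = Some ` V"
    | C where "compact C" "closed C" "U = insert None (Some ` (- C))"
    unfolding p1_top_def openin_Alexandroff_compactification by (auto simp: Compl_eq_Diff_UNIV)
  then show "open (Some -` U) \<and> (None \<in> U \<longrightarrow> (\<exists>R. \<forall>t. \<bar>t\<bar> > R \<longrightarrow> Some t \<in> U))"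
  proof cases
    case 1
    then have "Some -` U = V" by auto
    then show ?thesis using 1 by auto
  next
    case 2
    have "Some -` U = - C" using 2 by auto
    moreover obtain R where "\<forall>t\<in>C. norm t \<le> R"
      using compact_imp_bounded[OF 2(1)] by (auto simp: bounded_iff)
    then have "\<forall>t. \<bar>t\<bar> > R \<longrightarrow> Some t \<in> U" using 2(3) by force
    ultimately show ?thesis using 2 by auto
  qed
next
  assume *: "open (Some -` U) \<and> (None \<in> U \<longrightarrow> (\<exists>R. \<forall>t. \<bar>t\<bar> > R \<longrightarrow> Some t \<in> U))"
  show "openin p1_top U"
  proof (cases "None \<in> U")
    case True
    then obtain R where R: "\<forall>t. \<bar>t\<bar> > R \<longrightarrow> Some t \<in> U" using * by blast
    define C where "C = - (Some -` U)"
    have cl: "closed C" using * by (simp add: C_def closed_Compl)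
    have "\<forall>t\<in>C. norm t \<le> R" using R unfolding C_def by force
    then have "bounded C" by (auto simp: bounded_iff)
    with cl have "compact C" by (simp add: compact_eq_bounded_closed)
    moreover have "U = insert None (Some ` (UNIV - C))"
      using True unfolding C_def by (auto simp: image_iff split: option.split intro: option.exhaust)
    ultimately show ?thesis using cl unfolding p1_top_def openin_Alexandroff_compactification
      by auto
  next
    case False
    then have "U = Some ` (Some -` U)" by (auto simp: image_iff) (metis not_None_eq)
    then show ?thesis using * unfolding p1_top_def openin_Alexandroff_compactification
      by auto
  qed
qed

text \<open>The projective line carries the quotient topology of the punctured plane. In this form the
  continuity of the Moebius maps is that of linear maps, and the point at infinity needs no
  separate treatment.\<close>

lemma openin_p1_top_hom:
  "openin p1_top U \<longleftrightarrow> open {v. v \<noteq> 0 \<and> hom_pt v \<in> U}"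
proof
  assume "openin p1_top U"
  then have o: "open (Some -` U)" and inf: "None \<in> U \<Longrightarrow> \<exists>R. \<forall>t. \<bar>t\<bar> > R \<longrightarrow> Some t \<in> U"
    by (auto simp: openin_p1_top_iff)
  have fin: "open {v. snd v \<noteq> 0 \<and> fst v / snd v \<in> Some -` U}" (is "open ?F")
  proof -
    have "open {v::real \<times> real. snd v \<noteq> 0}"
      by (intro open_Collect_neq continuous_intros)
    moreover have "continuous_on {v::real \<times> real. snd v \<noteq> 0} (\<lambda>v. fst v / snd v)"
      by (intro continuous_intros) auto
    ultimately have "open ({v. snd v \<noteq> 0} \<inter> (\<lambda>v. fst v / snd v) -` (Some -` U))"
      using o continuous_open_preimage by blast
    then show ?thesis by (simp add: vimage_def Int_def)
  qed
  show "open {v. v \<noteq> 0 \<and> hom_pt v \<in> U}"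
  proof (cases "None \<in> U")
    case True
    then obtain R where R: "\<forall>t. \<bar>t\<bar> > R \<longrightarrow> Some t \<in> U" using inf by blast
    define R' where "R' = max R 0"
    have "open {v::real \<times> real. R' * \<bar>snd v\<bar> < \<bar>fst v\<bar>}" (is "open ?G")
      by (intro open_Collect_less continuous_intros)
    moreover have "{v. v \<noteq> 0 \<and> hom_pt v \<in> U} = ?F \<union> ?G"
    proof (rule Set.set_eqI, rule iffI)
      fix v assume "v \<in> {v. v \<noteq> 0 \<and> hom_pt v \<in> U}"
      then show "v \<in> ?F \<union> ?G"
        by (cases v) (auto simp: hom_pt_def zero_prod_def split: if_splits)
    next
      fix v assume v: "v \<in> ?F \<union> ?G"
      obtain x y where xy: "v = (x, y)" by fastforce
      show "v \<in> {v. v \<noteq> 0 \<and> hom_pt v \<in> U}"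
      proof (cases "v \<in> ?F")
        case True
        then show ?thesis using xy by (auto simp: hom_pt_def zero_prod_def)
      next
        case False
        then have g: "R' * \<bar>y\<bar> < \<bar>x\<bar>" using v xy by auto
        then have x: "x \<noteq> 0" by (auto simp: R'_def mult_less_0_iff)
        have "y \<noteq> 0 \<Longrightarrow> \<bar>x / y\<bar> > R"
        proof -
          assume "y \<noteq> 0"
          then have "R' < \<bar>x\<bar> / \<bar>y\<bar>" using g by (simp add: pos_less_divide_eq)
          then show ?thesis by (simp add: R'_def abs_divide)
        qed
        then show ?thesis using x xy R True by (auto simp: hom_pt_def zero_prod_def)
      qed
    qed
    ultimately show ?thesis using fin by auto
  next
    case False
    then have "{v. v \<noteq> 0 \<and> hom_pt v \<in> U} = ?F"
      by (auto simp: hom_pt_def zero_prod_def split: if_splits)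
    then show ?thesis using fin by simp
  qed
next
  assume o: "open {v. v \<noteq> 0 \<and> hom_pt v \<in> U}" (is "open ?W")
  have "open ((\<lambda>t. (t, 1)) -` ?W)" using o by (intro open_vimage continuous_intros)
  moreover have "(\<lambda>t. (t, 1)) -` ?W = Some -` U"
    by (auto simp: hom_pt_def zero_prod_def)
  ultimately have 1: "open (Some -` U)" by simp
  have "\<exists>R. \<forall>t. \<bar>t\<bar> > R \<longrightarrow> Some t \<in> U" if "None \<in> U"
  proof -
    have "open ((\<lambda>t. (1, t)) -` ?W)" using o by (intro open_vimage continuous_intros)
    moreover have "0 \<in> (\<lambda>t. (1, t)) -` ?W" using that by (simp add: hom_pt_def zero_prod_def)
    ultimately obtain e where e0: "e > 0" "ball 0 e \<subseteq> (\<lambda>t. (1, t)) -` ?W"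
      unfolding open_contains_ball by blast
    have e: "e > 0" "\<And>t. \<bar>t\<bar> < e \<Longrightarrow> (1, t) \<in> ?W"
      using e0 by (simp_all add: subset_iff)
    have "Some t \<in> U" if t: "\<bar>t\<bar> > 1 / e" for t
    proof -
      have t0: "t \<noteq> 0" using t e by auto
      then have "\<bar>1 / t\<bar> < e" using t e by (simp add: field_simps)
      from e(2)[OF this] show ?thesis using t0 by (auto simp: hom_pt_def)
    qed
    then show ?thesis by blast
  qed
  with 1 show "openin p1_top U" by (simp add: openin_p1_top_iff)
qed

lemma topspace_p1_top [simp]: "topspace p1_top = UNIV"
  by (simp add: p1_top_def UNIV_option_conv)

lemma compact_space_p1_top: "compact_space p1_top"
  by (simp add: p1_top_def)

lemma openin_mobius_vimage:
  assumes "Determinants.det M \<noteq> 0" "openin p1_top U"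
  shows "openin p1_top (mobius M -` U)"
proof -
  have e: "{v. v \<noteq> 0 \<and> hom_pt v \<in> mobius M -` U}
      = {v. v \<noteq> 0} \<inter> mat_act M -` {v. v \<noteq> 0 \<and> hom_pt v \<in> U}"
    using mat_act_nonzero[OF assms(1)] by (auto simp: mobius_hom_pt)
  have o: "open {v :: real \<times> real. v \<noteq> 0}" by (intro open_Collect_neq continuous_intros)
  show ?thesis
    unfolding openin_p1_top_hom e
    by (rule open_Int[OF o open_mat_act_vimage[OF assms(2)[unfolded openin_p1_top_hom]]])
qed

lemma homeomorphic_map_mobius:
  assumes "(Determinants.det M)\<^sup>2 = 1"
  shows "homeomorphic_map p1_top p1_top (mobius M)"
proof -
  obtain N where N: "M ** N = Finite_Cartesian_Product.mat 1" "N ** M = Finite_Cartesian_Product.mat 1"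
    "(Determinants.det N)\<^sup>2 = 1"
    using det_square_one_imp_inverse[OF assms] by blast
  have d: "Determinants.det M \<noteq> 0" "Determinants.det N \<noteq> 0" using assms N(3) by auto
  have "continuous_map p1_top p1_top (mobius K)" if "Determinants.det K \<noteq> 0" for K
    using openin_mobius_vimage[OF that] by (auto simp: continuous_map_def vimage_def)
  then have "homeomorphic_maps p1_top p1_top (mobius M) (mobius N)"
    using d N by (simp add: homeomorphic_maps_def mobius_mult[symmetric] mobius_one)
  then show ?thesis by (rule homeomorphic_maps_imp_map)
qed

lemma bij_mobius: "(Determinants.det M)\<^sup>2 = 1 \<Longrightarrow> bij (mobius M)"
  using homeomorphic_imp_injective_map[OF homeomorphic_map_mobius]
    homeomorphic_imp_surjective_map[OF homeomorphic_map_mobius] by (simp add: bij_def)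

lemma mobius_image_mult:
  "Determinants.det N \<noteq> 0 \<Longrightarrow> mobius (M ** N) ` S = mobius M ` mobius N ` S"
  by (simp add: image_image mobius_mult)

text \<open>The unimodular interval of the identity, in homogeneous coordinates the closed first
  quadrant.\<close>

definition nonneg_p1 :: "p1 set" where
  "nonneg_p1 = insert None (Some ` {0..})"

lemma uni_interval_nonneg: "uni_interval M = mobius M ` nonneg_p1"
  by (simp add: uni_interval_def nonneg_p1_def)

lemma nonneg_p1_hom: "x \<in> nonneg_p1 \<longleftrightarrow> (\<exists>v. v \<noteq> 0 \<and> fst v \<ge> 0 \<and> snd v \<ge> 0 \<and> x = hom_pt v)"
proof
  assume "x \<in> nonneg_p1"
  then consider "x = None" | t where "x = Some t" "t \<ge> 0" by (auto simp: nonneg_p1_def)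
  then show "\<exists>v. v \<noteq> 0 \<and> fst v \<ge> 0 \<and> snd v \<ge> 0 \<and> x = hom_pt v"
  proof cases
    case 1
    then show ?thesis by (intro exI[of _ "(1, 0)"]) (auto simp: hom_pt_def zero_prod_def)
  next
    case 2
    then show ?thesis by (intro exI[of _ "(t, 1)"]) (auto simp: hom_pt_def zero_prod_def)
  qed
next
  assume "\<exists>v. v \<noteq> 0 \<and> fst v \<ge> 0 \<and> snd v \<ge> 0 \<and> x = hom_pt v"
  then obtain v where "fst v \<ge> 0" "snd v \<ge> 0" "x = hom_pt v" by blast
  then show "x \<in> nonneg_p1" by (cases "snd v = 0") (simp_all add: nonneg_p1_def hom_pt_def)
qed

lemma closedin_nonneg_p1: "closedin p1_top nonneg_p1"
proof -
  have e: "{v. v \<noteq> 0 \<and> hom_pt v \<in> UNIV - nonneg_p1} = {v. fst v * snd v < (0::real)}"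
  proof (rule Set.set_eqI)
    fix v :: "real \<times> real"
    have "hom_pt v \<in> UNIV - nonneg_p1 \<longleftrightarrow> snd v \<noteq> 0 \<and> fst v / snd v < 0"
      by (auto simp: nonneg_p1_def hom_pt_def not_le[symmetric])
    also have "\<dots> \<longleftrightarrow> fst v * snd v < 0"
      by (auto simp: divide_less_0_iff mult_less_0_iff)
    finally show "v \<in> {v. v \<noteq> 0 \<and> hom_pt v \<in> UNIV - nonneg_p1} \<longleftrightarrow> v \<in> {v. fst v * snd v < 0}"
      by auto
  qed
  have "open {v. fst v * snd v < (0::real)}" by (intro open_Collect_less continuous_intros)
  then have "openin p1_top (UNIV - nonneg_p1)" unfolding openin_p1_top_hom e .
  then show ?thesis by (simp add: closedin_def)
qed

lemma openin_positive_p1: "openin p1_top (Some ` {0<..})"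
proof -
  have "Some -` Some ` {0<..} = {0::real<..}" by auto
  then show ?thesis by (auto simp: openin_p1_top_iff)
qed

lemma nonempty_open_contains_interval:
  assumes "openin p1_top U" "U \<noteq> {}"
  obtains s t where "s < t" "Some ` {s..t} \<subseteq> U"
proof -
  have o: "open (Some -` U)" using assms by (simp add: openin_p1_top_iff)
  obtain s where s: "Some s \<in> U"
  proof (cases "None \<in> U")
    case True
    then obtain R where "\<forall>t. \<bar>t\<bar> > R \<longrightarrow> Some t \<in> U" using assms by (auto simp: openin_p1_top_iff)
    then show thesis using that[of "\<bar>R\<bar> + 1"] by auto
  next
    case False
    then show thesis using assms(2) that by (metis ex_in_conv not_None_eq)
  qed
  then obtain e where e: "e > 0" "cball s e \<subseteq> Some -` U"
    using o unfolding open_contains_cball by (meson vimageI2)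
  have "{s..s + e} \<subseteq> cball s e" by (auto simp: dist_real_def)
  then show thesis using that[of s "s + e"] e by auto
qed

section \<open>Normal forms and the cells they address\<close>

text \<open>The normal form of an element of the monoid: the free word in l and n, and whether a letter f
  follows it.\<close>

lift_definition nf :: "sig \<Rightarrow> letter list \<times> bool" is "push False"
  by (rule push_word_eq)

definition word_of :: "sig \<Rightarrow> letter list" where "word_of s = fst (nf s)"
definition flipped :: "sig \<Rightarrow> bool" where "flipped s = snd (nf s)"

lemma nf_of_word: "nf (of_word u) = push False u"
  by (simp add: nf.abs_eq)

lemma sig_eq_nf: "s = of_word (word_of s) * (if flipped s then of_word [LetF] else 1)"
proof -
  obtain u where u: "s = of_word u"
    by (induction s rule: sig.abs_induct) blast
  show ?thesis
    unfolding u word_of_def flipped_def nf_of_word using of_word_push[of False u] by simp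
qed

lemma sig_eqI: "word_of s = word_of t \<Longrightarrow> flipped s = flipped t \<Longrightarrow> s = t"
  using sig_eq_nf by metis

lemma sig_len_word_of: "sig_len s = length (word_of s)"
proof -
  obtain u where u: "s = of_word u"
    by (induction s rule: sig.abs_induct) blast
  show ?thesis unfolding u sig_len_of_word word_of_def nf_of_word length_push ..
qed

lemma set_word_of: "set (word_of s) \<subseteq> {LetL, LetN}"
proof -
  obtain u where u: "s = of_word u"
    by (induction s rule: sig.abs_induct) blast
  show ?thesis unfolding u word_of_def nf_of_word by (rule set_push)
qed

lemma sig_len_mult: "sig_len (s * t) = sig_len s + sig_len t"
proof -
  obtain u v where "s = of_word u" "t = of_word v"
    using sig.abs_eq_iff sig.abs_induct[of "\<lambda>s. \<exists>u. s = of_word u"] by blast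
  then show ?thesis
    by (simp add: of_word_append[symmetric] sig_len_of_word)
qed

lemma sig_len_one: "sig_len 1 = 0"
  by (simp add: of_word_Nil[symmetric] sig_len_of_word)

lemma word_of_mult: "\<exists>v. word_of (s * t) = word_of s @ v"
proof -
  obtain u v where "s = of_word u" "t = of_word v"
    using sig.abs_eq_iff sig.abs_induct[of "\<lambda>s. \<exists>u. s = of_word u"] by blast
  then show ?thesis
    by (simp add: of_word_append[symmetric] word_of_def nf_of_word push_append)
qed

lemma finite_sig_len_le: "finite {s. sig_len s \<le> m}"
proof -
  have "inj_on (\<lambda>s. (word_of s, flipped s)) {s. sig_len s \<le> m}"
    by (auto intro!: inj_onI sig_eqI)
  moreover have "(\<lambda>s. (word_of s, flipped s)) ` {s. sig_len s \<le> m}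
      \<subseteq> {w. set w \<subseteq> {LetL, LetN} \<and> length w \<le> m} \<times> UNIV"
    using set_word_of by (auto simp: sig_len_word_of)
  moreover have "finite ({w. set w \<subseteq> {LetL, LetN} \<and> length w \<le> m} \<times> (UNIV :: bool set))"
    by (intro finite_cartesian_product finite_lists_length_le) auto
  ultimately show ?thesis by (meson finite_imageD finite_subset)
qed

lemma det_Proj: "(Determinants.det (Proj s))\<^sup>2 = 1"
proof -
  obtain u where u: "s = of_word u"
    by (induction s rule: sig.abs_induct) blast
  have "(Determinants.det (word_mat u))\<^sup>2 = 1"
  proof (induction u)
    case Nil
    then show ?case by (simp only: word_mat.simps det_I power_one)
  next
    case (Cons x u)
    have "(Determinants.det (letter_mat x))\<^sup>2 = 1"
      by (cases x) (simp_all only: letter_mat.simps det_2x2_int mat2_nth, simp_all)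
    then show ?case by (simp only: word_mat.simps det_mul power_mult_distrib Cons mult_1_right)
  qed
  then show ?thesis using u by (simp add: Proj.abs_eq)
qed

lemma det_Proj_nonzero: "Determinants.det (Proj s) \<noteq> 0"
  using det_Proj[of s] by auto

abbreviation sig_act :: "sig \<Rightarrow> p1 \<Rightarrow> p1" where "sig_act s \<equiv> mobius (Proj s)"

lemma sig_act_mult: "sig_act (s * t) x = sig_act s (sig_act t x)"
  by (simp add: Proj_mult mobius_mult det_Proj_nonzero)

lemma sig_act_one [simp]: "sig_act 1 x = x"
  by (simp add: Proj_one mobius_one)

lemma inj_sig_act: "inj (sig_act s)"
  using bij_mobius[OF det_Proj] by (simp add: bij_def)

lemma openin_sig_act: "openin p1_top U \<Longrightarrow> openin p1_top (sig_act s ` U)"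
  using homeomorphic_map_openness_eq[OF homeomorphic_map_mobius[OF det_Proj]] by blast

lemma closedin_sig_act: "closedin p1_top U \<Longrightarrow> closedin p1_top (sig_act s ` U)"
  using homeomorphic_map_closedness_eq[OF homeomorphic_map_mobius[OF det_Proj]] by blast

text \<open>The Farey interval addressed by s: the points coded by an infinite walk lie in the cells of the
  labels of all its prefixes.\<close>

definition cell :: "sig \<Rightarrow> p1 set" where
  "cell s = sig_act s ` nonneg_p1"

lemma cell_one: "cell 1 = nonneg_p1"
  by (simp add: cell_def)

lemma cell_mult: "cell (s * t) = sig_act s ` cell t"
  by (simp add: cell_def image_image sig_act_mult)

lemma sig_act_L: "sig_act (of_word [LetL]) x = (case x of None \<Rightarrow> Some 1
    | Some t \<Rightarrow> if t + 1 = 0 then None else Some (t / (t + 1)))"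
  by (cases x) (simp_all only: Proj_of_word letter_mat.simps mobius_def mat2_nth Let_def option.case,
      simp_all)

lemma sig_act_N: "sig_act (of_word [LetN]) x = map_option (\<lambda>t. t + 1) x"
  by (cases x) (simp_all only: Proj_of_word letter_mat.simps mobius_def mat2_nth Let_def option.case,
      simp_all)

lemma sig_act_F: "sig_act (of_word [LetF]) x = (case x of None \<Rightarrow> Some 0
    | Some t \<Rightarrow> if t = 0 then None else Some (1 / t))"
  by (cases x) (simp_all only: Proj_of_word letter_mat.simps mobius_def mat2_nth Let_def option.case,
      simp_all)

lemma cell_L: "cell (of_word [LetL]) = Some ` {0..1}"
proof (rule Set.set_eqI, rule iffI)
  fix x assume "x \<in> cell (of_word [LetL])"
  then show "x \<in> Some ` {0..1}"
    by (auto simp: cell_def nonneg_p1_def sig_act_L)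
next
  fix x assume "x \<in> Some ` {0..1::real}"
  then obtain t where t: "x = Some t" "0 \<le> t" "t \<le> 1" by auto
  show "x \<in> cell (of_word [LetL])"
  proof (cases "t = 1")
    case True
    then have "x = sig_act (of_word [LetL]) None" using t by (simp add: sig_act_L)
    then show ?thesis by (auto simp: cell_def nonneg_p1_def)
  next
    case False
    then have "x = sig_act (of_word [LetL]) (Some (t / (1 - t)))"
      using t by (simp add: sig_act_L field_simps)
    moreover have "t / (1 - t) \<ge> 0" using t by simp
    ultimately show ?thesis by (auto simp: cell_def nonneg_p1_def)
  qed
qed

lemma cell_N: "cell (of_word [LetN]) = insert None (Some ` {1..})"
proof (rule Set.set_eqI, rule iffI)
  fix x assume "x \<in> cell (of_word [LetN])"
  then show "x \<in> insert None (Some ` {1..})"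
    by (auto simp: cell_def nonneg_p1_def sig_act_N)
next
  fix x assume "x \<in> insert None (Some ` {1::real..})"
  then have "x = sig_act (of_word [LetN]) (map_option (\<lambda>t. t - 1) x)"
    "map_option (\<lambda>t. t - 1) x \<in> nonneg_p1"
    by (auto simp: sig_act_N nonneg_p1_def)
  then show "x \<in> cell (of_word [LetN])"
    unfolding cell_def by blast
qed

lemma cell_F: "cell (of_word [LetF]) = nonneg_p1"
proof -
  have sub: "sig_act (of_word [LetF]) ` nonneg_p1 \<subseteq> nonneg_p1"
    by (auto simp: nonneg_p1_def sig_act_F split: if_splits)
  have "x \<in> sig_act (of_word [LetF]) ` nonneg_p1" if "x \<in> nonneg_p1" for x
  proof
    show "x = sig_act (of_word [LetF]) (sig_act (of_word [LetF]) x)"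
      by (simp add: sig_act_mult[symmetric] of_word_relations)
    show "sig_act (of_word [LetF]) x \<in> nonneg_p1" using sub that by blast
  qed
  then show ?thesis using sub unfolding cell_def by blast
qed

lemma nonneg_split: "nonneg_p1 = cell (of_word [LetL]) \<union> cell (of_word [LetN])"
  unfolding cell_L cell_N nonneg_p1_def by force

lemma cell_subset_nonneg: "cell s \<subseteq> nonneg_p1"
proof -
  obtain u where u: "s = of_word u"
    by (induction s rule: sig.abs_induct) blast
  have "cell (of_word u) \<subseteq> nonneg_p1"
  proof (induction u)
    case Nil
    then show ?case by (simp add: of_word_Nil cell_one)
  next
    case (Cons x u)
    have "cell (of_word (x # u)) \<subseteq> cell (of_word [x])"
      using Cons unfolding of_word_Cons[of x u] cell_mult by (auto simp: cell_def)
    also have "cell (of_word [x]) \<subseteq> nonneg_p1"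
      using nonneg_split cell_F by (cases x) auto
    finally show ?case .
  qed
  then show ?thesis using u by simp
qed

lemma cell_mult_subset: "cell (s * t) \<subseteq> cell s"
  unfolding cell_mult using cell_subset_nonneg[of t] by (auto simp: cell_def)

text \<open>The inversion preserves the positive half-line, so a cell depends only on the free word of its
  label.\<close>

lemma cell_word_of: "cell (of_word (word_of s)) = cell s"
proof -
  have "cell s = sig_act (of_word (word_of s)) ` cell (if flipped s then of_word [LetF] else 1)"
    using sig_eq_nf[of s] by (metis cell_mult)
  also have "cell (if flipped s then of_word [LetF] else 1) = nonneg_p1"
    by (simp add: cell_F cell_one)
  finally show ?thesis by (simp add: cell_def[of "of_word _"])
qed

lemma cell_append_subset: "cell (of_word (u @ v)) \<subseteq> cell (of_word u)"
  by (simp add: of_word_append cell_mult_subset)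

lemma cell_snoc_split: "cell (of_word u) = cell (of_word (u @ [LetL])) \<union> cell (of_word (u @ [LetN]))"
proof -
  have "cell (of_word u) = sig_act (of_word u) ` (cell (of_word [LetL]) \<union> cell (of_word [LetN]))"
    by (simp only: nonneg_split[symmetric] cell_def[of "of_word u"])
  then show ?thesis by (simp add: of_word_append cell_mult image_Un)
qed

lemma cell_refine:
  assumes "x \<in> cell (of_word w)"
  shows "\<exists>u. length u = m \<and> set u \<subseteq> {LetL, LetN} \<and> x \<in> cell (of_word (w @ u))"
proof (induction m)
  case 0
  then show ?case using assms by simp
next
  case (Suc m)
  then obtain u where "length u = m" "set u \<subseteq> {LetL, LetN}" "x \<in> cell (of_word (w @ u))" by blast
  then show ?case
    using cell_snoc_split[of "w @ u"]
    by (intro exI[of _ "u @ [if x \<in> cell (of_word (w @ u @ [LetL])) then LetL else LetN]"]) auto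
qed

lemma closedin_cell: "closedin p1_top (cell s)"
  unfolding cell_def by (intro closedin_sig_act closedin_nonneg_p1)

lemma cell_interior: "\<exists>U. openin p1_top U \<and> U \<noteq> {} \<and> U \<subseteq> cell s"
proof (intro exI conjI)
  show "openin p1_top (sig_act s ` Some ` {0<..})"
    by (intro openin_sig_act openin_positive_p1)
  show "sig_act s ` Some ` {0<..} \<subseteq> cell s"
    unfolding cell_def nonneg_p1_def by auto
qed auto

text \<open>Each further letter adds one column to the other, so that the total of the entries grows at
  least linearly with the length of the word. The column sums are the denominators that control the size
  of a cell.\<close>

lemma word_mat_columns:
  assumes "set w \<subseteq> {LetL, LetN}"
  shows "(\<forall>i j. word_mat w $ i $ j \<ge> 0) \<and> Determinants.det (word_mat w) = 1 \<and>
    word_mat w $ 1 $ 1 + word_mat w $ 2 $ 1 \<ge> 1 \<and> word_mat w $ 1 $ 2 + word_mat w $ 2 $ 2 \<ge> 1 \<and>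
    word_mat w $ 1 $ 1 + word_mat w $ 2 $ 1 + (word_mat w $ 1 $ 2 + word_mat w $ 2 $ 2)
      \<ge> int (length w) + 2"
  using assms
proof (induction w rule: rev_induct)
  case Nil
  show ?case
    by (simp only: word_mat.simps mat2_one mat2_nth det_2x2_int forall_2) simp
next
  case (snoc x w)
  define a b c d where "a = word_mat w $ 1 $ 1" and "b = word_mat w $ 1 $ 2"
    and "c = word_mat w $ 2 $ 1" and "d = word_mat w $ 2 $ 2"
  have W: "word_mat w = mat2 a b c d"
    by (rule mat2_eqI) (simp_all only: a_def b_def c_def d_def)
  have IH: "a \<ge> 0" "b \<ge> 0" "c \<ge> 0" "d \<ge> 0" "a * d - b * c = 1" "a + c \<ge> 1" "b + d \<ge> 1"
    "a + c + (b + d) \<ge> int (length w) + 2"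
    using snoc.IH snoc.prems by (simp_all only: W det_2x2_int mat2_nth forall_2 set_append) auto
  have x: "x = LetL \<or> x = LetN" using snoc.prems by auto
  have wx: "word_mat (w @ [x]) = mat2 a b c d ** letter_mat x"
    by (simp only: word_mat_append W word_mat.simps matrix_mul_rid)
  from x show ?case
  proof
    assume x: "x = LetL"
    have "word_mat (w @ [x]) = mat2 (a + b) b (c + d) d"
      unfolding wx unfolding x by (simp only: letter_mat.simps mat2_mult mult_1_right mult_zero_right add_0_left)
    then show ?thesis using IH
      by (simp only: mat2_nth det_2x2_int forall_2) (simp add: algebra_simps)
  next
    assume x: "x = LetN"
    have "word_mat (w @ [x]) = mat2 a (a + b) c (c + d)"
      unfolding wx unfolding x by (simp only: letter_mat.simps mat2_mult mult_1_right mult_zero_right add_0_right)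
    then show ?thesis using IH
      by (simp only: mat2_nth det_2x2_int forall_2) (simp add: algebra_simps)
  qed
qed

text \<open>The coordinate \<open>x / (x + y)\<close> on the closed quadrant. It is finite at infinity as well, so that the
  size of all cells can be measured in it.\<close>

definition chart :: "p1 \<Rightarrow> real" where
  "chart x = (case x of None \<Rightarrow> 1 | Some t \<Rightarrow> t / (t + 1))"

lemma chart_hom_pt:
  assumes "v \<noteq> 0" "fst v \<ge> 0" "snd v \<ge> 0"
  shows "chart (hom_pt v) = fst v / (fst v + snd v)"
proof -
  obtain x y where v: "v = (x, y)" by fastforce
  show ?thesis
  proof (cases "y = 0")
    case True
    then show ?thesis using assms v by (auto simp: chart_def hom_pt_def zero_prod_def)
  next
    case False
    then have "x / y + 1 = (x + y) / y" by (simp add: field_simps)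
    then show ?thesis using False v by (simp add: chart_def hom_pt_def)
  qed
qed

lemma hom_pt_chart:
  assumes "x \<in> nonneg_p1"
  shows "x = hom_pt (chart x, 1 - chart x)"
proof -
  from assms consider "x = None" | t where "x = Some t" "t \<ge> 0" by (auto simp: nonneg_p1_def)
  then show ?thesis
  proof cases
    case 2
    then have "1 - t / (t + 1) = 1 / (t + 1)" by (simp add: field_simps)
    then show ?thesis using 2 by (simp add: chart_def hom_pt_def)
  qed (simp add: chart_def hom_pt_def)
qed

text \<open>For a matrix of determinant one with column sums C and D, the difference of the charts of the
  images of (p, q) and (p', q') is (p q' - p' q) / ((C p + D q) (C p' + D q')), hence at most 1 / (C D) in
  modulus; and C D is at least C + D - 1.\<close>

lemma cell_width:
  assumes "x \<in> cell s" "y \<in> cell s"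
  shows "\<bar>chart x - chart y\<bar> \<le> 1 / (real (sig_len s) + 1)"
proof -
  define w where "w = word_of s"
  have w: "set w \<subseteq> {LetL, LetN}" "sig_len s = length w"
    using set_word_of sig_len_word_of by (auto simp: w_def)
  define a b c d where "a = real_of_int (word_mat w $ 1 $ 1)" and "b = real_of_int (word_mat w $ 1 $ 2)"
    and "c = real_of_int (word_mat w $ 2 $ 1)" and "d = real_of_int (word_mat w $ 2 $ 2)"
  note W = word_mat_columns[OF w(1)]
  have nn: "a \<ge> 0" "b \<ge> 0" "c \<ge> 0" "d \<ge> 0"
    using W by (auto simp: a_def b_def c_def d_def)
  have det: "a * d - b * c = 1"
  proof -
    have "word_mat w $ 1 $ 1 * word_mat w $ 2 $ 2 - word_mat w $ 1 $ 2 * word_mat w $ 2 $ 1 = 1"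
      using W by (simp only: det_2x2_int)
    from arg_cong[OF this, of real_of_int] show ?thesis
      by (simp only: of_int_diff of_int_mult of_int_1 a_def b_def c_def d_def)
  qed
  define C D where "C = a + c" and "D = b + d"
  have "1 \<le> word_mat w $ 1 $ 1 + word_mat w $ 2 $ 1" "1 \<le> word_mat w $ 1 $ 2 + word_mat w $ 2 $ 2"
    "int (length w) + 2 \<le>
      word_mat w $ 1 $ 1 + word_mat w $ 2 $ 1 + (word_mat w $ 1 $ 2 + word_mat w $ 2 $ 2)"
    using W by blast+
  then have CD: "C \<ge> 1" "D \<ge> 1" "C + D \<ge> real (length w) + 2"
    unfolding C_def D_def a_def b_def c_def d_def by linarith+
  have CD': "C * D \<ge> real (length w) + 1"
  proof -
    have "(C - 1) * (D - 1) \<ge> 0" using CD by simp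
    then have "C * D \<ge> C + D - 1" by (simp add: algebra_simps)
    then show ?thesis using CD by linarith
  qed
  have coords: "\<exists>p q. p \<ge> 0 \<and> q \<ge> 0 \<and> C * p + D * q > 0 \<and> chart z = (a * p + b * q) / (C * p + D * q)"
    if z: "z \<in> cell s" for z
  proof -
    have "z \<in> mobius (word_mat w) ` nonneg_p1"
      using z cell_word_of[of s] by (simp add: cell_def w_def Proj.abs_eq)
    then obtain v where v: "v \<noteq> 0" "fst v \<ge> 0" "snd v \<ge> 0" "z = mobius (word_mat w) (hom_pt v)"
      by (auto simp: nonneg_p1_hom)
    obtain p q where pq: "v = (p, q)" by fastforce
    have m: "mat_act (word_mat w) v = (a * p + b * q, c * p + d * q)"
      by (simp add: mat_act_def pq a_def b_def c_def d_def)
    have dn: "Determinants.det (word_mat w) \<noteq> 0" using W by simp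
    have nz: "mat_act (word_mat w) v \<noteq> 0"
      by (rule mat_act_nonzero[OF dn v(1)])
    have p0: "p \<ge> 0" "q \<ge> 0" "p \<noteq> 0 \<or> q \<noteq> 0" using v pq by (auto simp: zero_prod_def)
    have "chart z = (a * p + b * q) / (a * p + b * q + (c * p + d * q))"
      using chart_hom_pt[OF nz] p0 nn by (simp add: v mobius_hom_pt m)
    moreover have "a * p + b * q + (c * p + d * q) = C * p + D * q"
      by (simp add: C_def D_def algebra_simps)
    moreover have "C * p + D * q > 0"
    proof -
      have "C * p \<ge> p" "D * q \<ge> q"
        using mult_right_mono[OF CD(1) p0(1)] mult_right_mono[OF CD(2) p0(2)] by simp_all
      then show ?thesis using p0 by linarith
    qed
    ultimately show ?thesis using p0 by auto
  qed
  obtain p q where 1: "p \<ge> 0" "q \<ge> 0" "C * p + D * q > 0" "chart x = (a * p + b * q) / (C * p + D * q)"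
    using coords[OF assms(1)] by blast
  obtain p' q' where 2: "p' \<ge> 0" "q' \<ge> 0" "C * p' + D * q' > 0"
    "chart y = (a * p' + b * q') / (C * p' + D * q')"
    using coords[OF assms(2)] by blast
  define P where "P = (C * p + D * q) * (C * p' + D * q')"
  have P: "P > 0" using 1 2 by (simp add: P_def)
  have "chart x - chart y = ((a * p + b * q) * (C * p' + D * q') - (a * p' + b * q') * (C * p + D * q)) / P"
    unfolding 1(4) 2(4) P_def using 1(3) 2(3) by (intro diff_frac_eq) auto
  also have "(a * p + b * q) * (C * p' + D * q') - (a * p' + b * q') * (C * p + D * q)
      = (a * d - b * c) * (p * q' - p' * q)"
    by (simp add: C_def D_def algebra_simps)
  finally have e: "\<bar>chart x - chart y\<bar> = \<bar>p * q' - p' * q\<bar> / P"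
    using det P by simp
  have "(real (length w) + 1) * \<bar>p * q' - p' * q\<bar> \<le> C * D * \<bar>p * q' - p' * q\<bar>"
    using CD' by (intro mult_right_mono) auto
  also have "\<dots> \<le> C * D * (p * q' + p' * q)"
  proof (intro mult_left_mono)
    have "p * q' \<ge> 0" "p' * q \<ge> 0" using 1 2 by simp_all
    then show "\<bar>p * q' - p' * q\<bar> \<le> p * q' + p' * q" by linarith
  qed (use CD in simp)
  also have "\<dots> \<le> P"
  proof -
    have "P = C * D * (p * q' + p' * q) + C * C * (p * p') + D * D * (q * q')"
      by (simp add: P_def algebra_simps)
    moreover have "C * C * (p * p') \<ge> 0" "D * D * (q * q') \<ge> 0" using 1 2 CD by simp_all
    ultimately show ?thesis by linarith
  qed
  finally show ?thesis
    unfolding e w(2) using P by (simp add: field_simps)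
qed

lemma cells_shrink:
  assumes "openin p1_top U" "x \<in> U" "x \<in> nonneg_p1"
  shows "\<exists>m. \<forall>s. sig_len s \<ge> m \<and> x \<in> cell s \<longrightarrow> cell s \<subseteq> U"
proof -
  define g where "g = (\<lambda>t::real. (t, 1 - t))"
  have "open (g -` {v. v \<noteq> 0 \<and> hom_pt v \<in> U})"
    using assms(1) unfolding openin_p1_top_hom g_def by (intro open_vimage continuous_intros)
  moreover have "chart x \<in> g -` {v. v \<noteq> 0 \<and> hom_pt v \<in> U}"
    using hom_pt_chart[OF assms(3)] assms(2) by (auto simp: g_def zero_prod_def)
  ultimately obtain e where e: "e > 0" "ball (chart x) e \<subseteq> g -` {v. v \<noteq> 0 \<and> hom_pt v \<in> U}"
    unfolding open_contains_ball by blast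
  obtain m :: nat where m: "real m > 1 / e" using reals_Archimedean2 by blast
  have "y \<in> U" if s: "sig_len s \<ge> m" "x \<in> cell s" and y: "y \<in> cell s" for s y
  proof -
    have "1 / e < real (sig_len s) + 1" using m s(1) by linarith
    then have "1 / (real (sig_len s) + 1) < e" using e(1) by (simp add: field_simps)
    then have "dist (chart x) (chart y) < e"
      using cell_width[OF s(2) y] by (simp add: dist_real_def)
    then have "hom_pt (g (chart y)) \<in> U" using e(2) by auto
    moreover have "y \<in> nonneg_p1" using y cell_subset_nonneg by blast
    ultimately show ?thesis using hom_pt_chart[of y] by (simp add: g_def)
  qed
  then show ?thesis by blast
qed

lemma cells_separate:
  assumes "\<And>m. \<exists>s. sig_len s \<ge> m \<and> x \<in> cell s \<and> y \<in> cell s"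
  shows "x = y"
proof -
  have nn: "x \<in> nonneg_p1" "y \<in> nonneg_p1" using assms cell_subset_nonneg by blast+
  have "chart x = chart y"
  proof (rule ccontr)
    assume ne: "chart x \<noteq> chart y"
    obtain m :: nat where m: "real m > 1 / \<bar>chart x - chart y\<bar>" using reals_Archimedean2 by blast
    obtain s where s: "sig_len s \<ge> m" "x \<in> cell s" "y \<in> cell s" using assms by blast
    have "\<bar>chart x - chart y\<bar> \<le> 1 / (real (sig_len s) + 1)" by (rule cell_width[OF s(2,3)])
    then have "real (sig_len s) + 1 \<le> 1 / \<bar>chart x - chart y\<bar>"
      using ne by (simp add: field_simps)
    then show False using m s(1) by linarith
  qed
  then show ?thesis using hom_pt_chart nn by metis
qed

text \<open>Cells of one level overlap only in rational points, so that an irrational point has a unique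
  expansion in the letters l and n.\<close>

definition irrational_pts :: "p1 set" where
  "irrational_pts = Some ` (- \<rat>)"

lemma irrational_sig_act: "sig_act s x \<in> irrational_pts \<longleftrightarrow> x \<in> irrational_pts"
proof -
  have rat: "mobius M x \<notin> irrational_pts" if "x \<notin> irrational_pts" for M x
    using that by (cases x) (auto simp: irrational_pts_def mobius_def Let_def)
  obtain N where N: "N ** Proj s = Finite_Cartesian_Product.mat 1"
    using det_square_one_imp_inverse[OF det_Proj] by blast
  have "mobius N (sig_act s x) = x"
    by (simp add: mobius_mult[symmetric] det_Proj_nonzero N mobius_one)
  then show ?thesis using rat by metis
qed

lemma irrational_cell_nonempty: "\<exists>x \<in> cell s. x \<in> irrational_pts"
proof -
  have "\<not> {0<..<1::real} \<subseteq> \<rat>"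
    using countable_rat countable_subset uncountable_open_interval[of 0 "1::real"] by force
  then obtain t :: real where "t > 0" "t \<notin> \<rat>" by (auto simp: subset_iff)
  then have "Some t \<in> nonneg_p1" "Some t \<in> irrational_pts"
    by (auto simp: nonneg_p1_def irrational_pts_def)
  then show ?thesis using irrational_sig_act unfolding cell_def by blast
qed

lemma irrational_word_unique:
  assumes "x \<in> irrational_pts" "x \<in> cell (of_word u)" "x \<in> cell (of_word v)"
    "set u \<subseteq> {LetL, LetN}" "set v \<subseteq> {LetL, LetN}" "length u = length v"
  shows "u = v"
  using assms
proof (induction u arbitrary: x v)
  case (Cons a u)
  obtain b v' where v: "v = b # v'" using Cons.prems by (cases v) auto
  have "x \<in> cell (of_word [a])" "x \<in> cell (of_word [b])"
    using Cons.prems cell_append_subset[of "[a]" u] cell_append_subset[of "[b]" v'] v by auto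
  moreover have "x \<noteq> Some 1" using Cons.prems(1) by (auto simp: irrational_pts_def)
  ultimately have ab: "a = b" using Cons.prems(4,5) v by (auto simp: cell_L cell_N)
  obtain y where y: "x = sig_act (of_word [a]) y" "y \<in> cell (of_word u)"
    using Cons.prems(2) unfolding of_word_Cons[of a u] cell_mult by blast
  obtain z where z: "x = sig_act (of_word [b]) z" "z \<in> cell (of_word v')"
    using Cons.prems(3) unfolding v of_word_Cons[of b v'] cell_mult by blast
  have "y = z" using y z ab inj_sig_act by (metis injD)
  moreover have "y \<in> irrational_pts" using Cons.prems(1) y irrational_sig_act by blast
  ultimately have "u = v'" using Cons.IH[of y v'] Cons.prems y z v by auto
  then show ?case using ab v by simp
qed simp

section \<open>Walks in the graph of a code\<close>

definition walk_lab :: "edge list \<Rightarrow> sig" where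
  "walk_lab p = prod_list (map lab p)"

abbreviation walk_len :: "edge list \<Rightarrow> nat" where
  "walk_len p \<equiv> sig_len (walk_lab p)"

lemma walk_lab_simps [simp]:
  "walk_lab [] = 1" "walk_lab (a # p) = lab a * walk_lab p"
  "walk_lab (p @ q) = walk_lab p * walk_lab q"
  by (simp_all add: walk_lab_def)

definition prefix :: "(nat \<Rightarrow> edge) \<Rightarrow> nat \<Rightarrow> edge list" where
  "prefix p t = map p [0..<t]"

lemma prefix_simps [simp]: "prefix p 0 = []" "prefix p (Suc t) = prefix p t @ [p t]"
  "length (prefix p t) = t"
  by (simp_all add: prefix_def)

lemma prefix_case_nat: "prefix (case_nat a p) (Suc t) = a # prefix p t"
  by (induction t) auto

lemma cell_prefix_antimono: "t \<le> t' \<Longrightarrow> cell (walk_lab (prefix p t')) \<subseteq> cell (walk_lab (prefix p t))"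
  by (induction rule: dec_induct) (use cell_mult_subset in auto)

locale finite_code =
  fixes n :: nat and A :: "edge set"
  assumes finite_A: "finite A" and code: "is_code n A"
begin

fun walk :: "nat \<Rightarrow> edge list \<Rightarrow> nat \<Rightarrow> bool" where
  "walk i [] j \<longleftrightarrow> i = j"
| "walk i (a # p) j \<longleftrightarrow> a \<in> A \<and> src a = i \<and> walk (tgt a) p j"

lemma walk_append: "walk i (p @ q) k \<longleftrightarrow> (\<exists>j. walk i p j \<and> walk j q k)"
  by (induction p arbitrary: i) auto

lemma walk_edges: "walk i p j \<Longrightarrow> set p \<subseteq> A"
  by (induction p arbitrary: i) auto

lemma edge_nodes: "a \<in> A \<Longrightarrow> src a < n \<and> tgt a < n"
  using code by (auto simp: is_code_def sig_tilde_def src_def tgt_def)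

lemma walk_nodes: "walk i p j \<Longrightarrow> i < n \<Longrightarrow> j < n"
  by (induction p arbitrary: i) (auto dest: edge_nodes)

lemma walk_edge_prod: "walk i p j \<Longrightarrow> p \<noteq> [] \<Longrightarrow> edge_prod p = Some (i, walk_lab p, j)"
proof (induction p arbitrary: i rule: edge_prod.induct)
  case (2 a)
  then show ?case by (simp add: src_def lab_def tgt_def prod_eq_iff)
next
  case (3 a b p)
  then have b: "edge_prod (b # p) = Some (tgt a, walk_lab (b # p), j)" and a: "src a = i" by auto
  have "edge_mult a (tgt a, walk_lab (b # p), j) = Some (i, lab a * walk_lab (b # p), j)"
    by (simp only: edge_mult_def src_def[of "(_, _)"] lab_def[of "(_, _)"] tgt_def[of "(_, _)"]
        fst_conv snd_conv a if_True simp_thms)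
  then show ?case using b by simp
qed simp

lemma walk_unique:
  assumes "walk i p j" "walk i q j" "p \<noteq> []" "q \<noteq> []" "walk_lab p = walk_lab q"
  shows "p = q"
proof -
  have "edge_prod p = Some (i, walk_lab p, j)" "edge_prod q = Some (i, walk_lab q, j)"
    using walk_edge_prod assms(1-4) by blast+
  then show ?thesis
    using code walk_edges[OF assms(1)] walk_edges[OF assms(2)] assms(5)
    unfolding is_code_def by (metis option.distinct(1))
qed

text \<open>Edges of length zero may occur, but the code property prevents them from piling up: a walk is
  determined by its label and its end node, and there are only finitely many labels of bounded length.\<close>

lemma finite_walks_len_le: "finite {p. (\<exists>j. walk i p j) \<and> walk_len p \<le> m}"
proof (cases "i < n")
  case True
  define S where "S = {p. (\<exists>j. walk i p j) \<and> walk_len p \<le> m \<and> p \<noteq> []}"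
  define g where "g p = (walk_lab p, tgt (last p))" for p
  have last: "j = tgt (last p)" if "walk i p j" "p \<noteq> []" for i p j
    using that by (induction p arbitrary: i) (auto split: if_splits)
  have "inj_on g S"
    using last by (intro inj_onI) (auto simp: S_def g_def intro: walk_unique)
  moreover have "g ` S \<subseteq> {s. sig_len s \<le> m} \<times> {..<n}"
    using last walk_nodes True by (fastforce simp: S_def g_def)
  moreover have "finite ({s. sig_len s \<le> m} \<times> {..<n})"
    using finite_sig_len_le by blast
  ultimately have "finite S" using finite_imageD finite_subset by blast
  moreover have "{p. (\<exists>j. walk i p j) \<and> walk_len p \<le> m} \<subseteq> insert [] S"
    by (auto simp: S_def)
  ultimately show ?thesis by (meson finite_insert finite_subset)
next
  case False
  then have "p = []" if "walk i p j" for p j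
    using that edge_nodes by (cases p) auto
  then have "{p. (\<exists>j. walk i p j) \<and> walk_len p \<le> m} \<subseteq> {[]}" by blast
  then show ?thesis by (meson finite.simps finite_subset)
qed

definition len_bound :: nat where
  "len_bound = (\<Sum>a\<in>A. sig_len (lab a))"

lemma edge_len_le: "a \<in> A \<Longrightarrow> sig_len (lab a) \<le> len_bound"
  unfolding len_bound_def using finite_A by (intro member_le_sum) auto

lemma walk_len_le: "walk i p j \<Longrightarrow> walk_len p \<le> len_bound * length p"
proof (induction p arbitrary: i)
  case (Cons a p)
  then have "walk_len p \<le> len_bound * length p" "sig_len (lab a) \<le> len_bound"
    using edge_len_le by auto
  then show ?case by (simp add: sig_len_mult)
qed (simp add: sig_len_one)

section \<open>The limit set of infinite walks\<close>

lemma walk_prefix: "p \<in> inf_paths A i \<Longrightarrow> walk i (prefix p t) (src (p t))"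
  by (induction t) (auto simp: inf_paths_def walk_append)

lemma inf_pathsI:
  assumes "\<And>t. \<exists>j. walk i (prefix p t) j"
  shows "p \<in> inf_paths A i"
proof -
  have 1: "p t \<in> A" "tgt (p t) = src (p (Suc t))" for t
    using assms[of "Suc (Suc t)"] by (auto simp: walk_append)
  moreover have "src (p 0) = i" using assms[of "Suc 0"] by auto
  ultimately show ?thesis by (auto simp: inf_paths_def)
qed

lemma prefix_len_unbounded:
  assumes "p \<in> inf_paths A i"
  shows "\<exists>t. walk_len (prefix p t) \<ge> m"
proof (rule ccontr)
  assume "\<not> ?thesis"
  then have "walk_len (prefix p t) \<le> m" for t by (meson nat_le_linear)
  then have "range (prefix p) \<subseteq> {q. (\<exists>j. walk i q j) \<and> walk_len q \<le> m}"
    using walk_prefix[OF assms] by blast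
  then have "finite (range (prefix p))" using finite_walks_len_le finite_subset by blast
  moreover have "inj (prefix p)"
    by (rule injI) (metis prefix_simps(3))
  ultimately show False using finite_imageD infinite_UNIV_nat by blast
qed

definition codings :: "nat \<Rightarrow> p1 \<Rightarrow> (nat \<Rightarrow> edge) set" where
  "codings i x = {p \<in> inf_paths A i. \<forall>t. x \<in> cell (walk_lab (prefix p t))}"

text \<open>The attractor in the half-line model, where every node carries the interval of the identity
  matrix.\<close>

definition limit_set :: "nat \<Rightarrow> p1 set" where
  "limit_set i = {x. codings i x \<noteq> {}}"

lemma codings_unique:
  assumes "p \<in> codings i x" "p \<in> codings i y"
  shows "x = y"
proof (rule cells_separate)
  fix m
  obtain t where "walk_len (prefix p t) \<ge> m"
    using prefix_len_unbounded assms unfolding codings_def by blast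
  then show "\<exists>s. sig_len s \<ge> m \<and> x \<in> cell s \<and> y \<in> cell s"
    using assms unfolding codings_def by blast
qed

lemma codings_exist: "\<exists>x. x \<in> (\<Inter>t. cell (walk_lab (prefix p t)))"
proof -
  have "\<Inter> (range (\<lambda>t. cell (walk_lab (prefix p t)))) \<noteq> {}"
  proof (rule compact_space_fip[THEN iffD1, OF compact_space_p1_top, rule_format], intro conjI ballI allI impI)
    fix C assume "C \<in> range (\<lambda>t. cell (walk_lab (prefix p t)))"
    then show "closedin p1_top C" using closedin_cell by blast
  next
    fix \<F> assume F: "finite \<F> \<and> \<F> \<subseteq> range (\<lambda>t. cell (walk_lab (prefix p t)))"
    then obtain T where T: "finite T" "\<F> = (\<lambda>t. cell (walk_lab (prefix p t))) ` T"
      using finite_subset_image by metis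
    define m where "m = Max (insert 0 T)"
    have "cell (walk_lab (prefix p m)) \<subseteq> \<Inter>\<F>"
      unfolding T(2) using T(1) by (intro INT_greatest cell_prefix_antimono) (simp add: m_def)
    then show "\<Inter>\<F> \<noteq> {}" using irrational_cell_nonempty by blast
  qed
  then show ?thesis by blast
qed

lemma codings_Cons:
  assumes "a \<in> A" "p \<in> codings (tgt a) y"
  shows "case_nat a p \<in> codings (src a) (sig_act (lab a) y)"
proof -
  have p: "p \<in> inf_paths A (tgt a)" "\<And>t. y \<in> cell (walk_lab (prefix p t))"
    using assms by (auto simp: codings_def)
  have "case_nat a p \<in> inf_paths A (src a)"
    using p(1) assms(1) by (auto simp: inf_paths_def split: nat.split)
  moreover have "sig_act (lab a) y \<in> cell (walk_lab (prefix (case_nat a p) t))" for t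
  proof (cases t)
    case 0
    have "y \<in> nonneg_p1" using p(2)[of 0] by (simp add: cell_one)
    then have "sig_act (lab a) y \<in> cell (lab a)" by (auto simp: cell_def)
    then show ?thesis using 0 cell_subset_nonneg by (auto simp: cell_one)
  next
    case (Suc t')
    then show ?thesis using p(2)[of t'] by (simp add: prefix_case_nat cell_mult del: prefix_simps(2))
  qed
  ultimately show ?thesis by (simp add: codings_def)
qed

lemma limit_set_edge: "a \<in> A \<Longrightarrow> sig_act (lab a) ` limit_set (tgt a) \<subseteq> limit_set (src a)"
  using codings_Cons unfolding limit_set_def by blast

lemma limit_set_walk: "walk i p j \<Longrightarrow> sig_act (walk_lab p) ` limit_set j \<subseteq> limit_set i"
proof (induction p arbitrary: i)
  case (Cons a p)
  then have "sig_act (walk_lab p) ` limit_set j \<subseteq> limit_set (tgt a)" "a \<in> A" "src a = i" by auto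
  then show ?case using limit_set_edge[of a] by (fastforce simp: sig_act_mult)
qed simp

lemma limit_set_subset: "limit_set i \<subseteq> nonneg_p1"
proof
  fix x assume "x \<in> limit_set i"
  then obtain p where "p \<in> codings i x" by (auto simp: limit_set_def)
  then have "x \<in> cell (walk_lab (prefix p 0))" unfolding codings_def by blast
  then show "x \<in> nonneg_p1" by (simp add: cell_one)
qed

lemma limit_set_small_cell:
  assumes "x \<in> limit_set i" "openin p1_top U" "x \<in> U"
  obtains p j where "walk i p j" "cell (walk_lab p) \<subseteq> U"
proof -
  obtain p where p: "p \<in> codings i x" using assms(1) by (auto simp: limit_set_def)
  obtain m where m: "\<And>s. sig_len s \<ge> m \<Longrightarrow> x \<in> cell s \<Longrightarrow> cell s \<subseteq> U"
    using cells_shrink[OF assms(2,3)] assms(1) limit_set_subset by blast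
  obtain t where "walk_len (prefix p t) \<ge> m"
    using prefix_len_unbounded p unfolding codings_def by blast
  then have "cell (walk_lab (prefix p t)) \<subseteq> U" using m p by (simp add: codings_def)
  moreover have "walk i (prefix p t) (src (p t))" using p walk_prefix by (simp add: codings_def)
  ultimately show thesis using that by blast
qed

text \<open>Koenig's lemma: the graph is finitely branching, so arbitrarily long walks whose cells contain
  a point can be chosen as the prefixes of one infinite walk.\<close>

lemma limit_set_iff:
  "x \<in> limit_set i \<longleftrightarrow> (\<forall>k. \<exists>p j. walk i p j \<and> length p = k \<and> x \<in> cell (walk_lab p))"
proof
  assume "x \<in> limit_set i"
  then obtain p where "p \<in> codings i x" by (auto simp: limit_set_def)
  then have "walk i (prefix p k) (src (p k)) \<and> length (prefix p k) = k \<and> x \<in> cell (walk_lab (prefix p k))" for k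
    using walk_prefix by (auto simp: codings_def)
  then show "\<forall>k. \<exists>p j. walk i p j \<and> length p = k \<and> x \<in> cell (walk_lab p)" by blast
next
  assume long: "\<forall>k. \<exists>p j. walk i p j \<and> length p = k \<and> x \<in> cell (walk_lab p)"
  define good where "good p \<longleftrightarrow> (\<exists>j. walk i p j) \<and> x \<in> cell (walk_lab p)" for p
  define ext where "ext p \<longleftrightarrow> (\<forall>k. \<exists>q. length q = k \<and> good (p @ q))" for p
  have good_append: "good p" if "good (p @ q)" for p q
    using that cell_mult_subset by (auto simp: good_def walk_append)
  have step: "\<exists>a. ext (p @ [a])" if e: "ext p" for p
  proof (rule ccontr)
    assume "\<not> ?thesis"
    then have "\<forall>a. \<exists>k. \<forall>q. length q = k \<longrightarrow> \<not> good (p @ [a] @ q)"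
      by (auto simp: ext_def)
    then obtain k where k: "\<And>a q. length q = k a \<Longrightarrow> \<not> good (p @ [a] @ q)" by metis
    obtain r where r: "length r = Suc (\<Sum>a\<in>A. k a)" "good (p @ r)"
      using e unfolding ext_def by blast
    obtain a q where aq: "r = a # q" using r by (cases r) auto
    have "a \<in> A" using r(2) by (auto simp: aq good_def walk_append)
    then have "k a \<le> (\<Sum>a\<in>A. k a)" using finite_A by (intro member_le_sum) auto
    then have "length (take (k a) q) = k a" using r aq by simp
    moreover have "good (p @ [a] @ take (k a) q)"
      using r(2) good_append[of "p @ [a] @ take (k a) q" "drop (k a) q"] by (simp add: aq)
    ultimately show False using k by blast
  qed
  then obtain nx where nx: "\<And>p. ext p \<Longrightarrow> ext (p @ [nx p])" by metis
  define s where "s = rec_nat [] (\<lambda>_ p. p @ [nx p])"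
  define P where "P t = nx (s t)" for t
  have s: "s 0 = []" "\<And>t. s (Suc t) = s t @ [P t]" by (simp_all add: s_def P_def)
  have "prefix P t = s t" for t by (induction t) (simp_all add: s)
  moreover have "ext (s t)" for t
  proof (induction t)
    case 0
    show ?case using long unfolding s ext_def good_def append_Nil by blast
  next
    case (Suc t)
    then show ?case using nx by (simp add: s P_def)
  qed
  then have "good (s t)" for t
    unfolding ext_def by (metis append_Nil2 length_0_conv)
  ultimately have "P \<in> codings i x"
    by (auto simp: codings_def good_def intro!: inf_pathsI)
  then show "x \<in> limit_set i" by (auto simp: limit_set_def)
qed

lemma closedin_limit_set: "closedin p1_top (limit_set i)"
proof -
  define W where "W k = {p. (\<exists>j. walk i p j) \<and> length p = k}" for k
  have "W k \<subseteq> {p. set p \<subseteq> A \<and> length p = k}" for k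
    using walk_edges by (auto simp: W_def)
  then have fin: "finite (W k)" for k
    using finite_lists_length_eq[OF finite_A] finite_subset by blast
  have "closedin p1_top (\<Inter>k. \<Union>p\<in>W k. cell (walk_lab p))"
    using fin closedin_cell by (intro closedin_Inter) (auto intro!: closedin_Union)
  moreover have "limit_set i = (\<Inter>k. \<Union>p\<in>W k. cell (walk_lab p))"
    by (auto simp: limit_set_iff W_def)
  ultimately show ?thesis by simp
qed

section \<open>Every limit set has interior\<close>

definition walk_end :: "nat \<Rightarrow> edge list \<Rightarrow> nat" where
  "walk_end i p = (if p = [] then i else tgt (last p))"

lemma walk_end: "walk i p j \<Longrightarrow> walk_end i p = j"
  by (induction p arbitrary: i) (auto simp: walk_end_def split: if_splits)

text \<open>The walks at the moment when their length reaches m. No such walk extends another one, and every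
  infinite walk passes through exactly one of them.\<close>

definition crossing :: "nat \<Rightarrow> nat \<Rightarrow> edge list set" where
  "crossing i m = {p. (\<exists>j. walk i p j) \<and> m \<le> walk_len p \<and> (p \<noteq> [] \<longrightarrow> walk_len (butlast p) < m)}"

lemma walk_butlast:
  assumes "walk i p j" "p \<noteq> []"
  shows "walk i (butlast p) (src (last p))" "last p \<in> A"
    "walk_lab p = walk_lab (butlast p) * lab (last p)"
proof -
  obtain q a where p: "p = q @ [a]" using assms(2) by (metis rev_exhaust)
  show "walk i (butlast p) (src (last p))" "last p \<in> A" using assms(1) by (auto simp: p walk_append)
  show "walk_lab p = walk_lab (butlast p) * lab (last p)" by (simp add: p)
qed

lemma crossing_len: "p \<in> crossing i m \<Longrightarrow> walk_len p \<le> m + len_bound"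
proof (cases "p = []")
  case False
  assume "p \<in> crossing i m"
  then obtain j where "walk i p j" "walk_len (butlast p) < m" using False by (auto simp: crossing_def)
  then show ?thesis
    using walk_butlast[of i p j] edge_len_le[of "last p"] False by (simp add: sig_len_mult)
qed (simp add: sig_len_one)

lemma finite_crossing: "finite (crossing i m)"
  using crossing_len finite_walks_len_le[of i "m + len_bound"]
  by (rule_tac finite_subset[rotated]) (auto simp: crossing_def)

lemma crossing_antichain:
  assumes "p \<in> crossing i m" "p @ r \<in> crossing i m"
  shows "r = []"
proof (rule ccontr)
  assume r: "r \<noteq> []"
  then have "walk_len (p @ butlast r) < m" using assms(2) by (auto simp: crossing_def butlast_append)
  then show False using assms(1) by (auto simp: crossing_def sig_len_mult)
qed

definition weight :: "(nat \<Rightarrow> real) \<Rightarrow> nat \<Rightarrow> edge list \<Rightarrow> real" where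
  "weight v i p = v (walk_end i p) / 2 ^ walk_len p"

definition subinvariant :: "(nat \<Rightarrow> real) \<Rightarrow> bool" where
  "subinvariant v \<longleftrightarrow> (\<forall>i. v i \<ge> 0) \<and>
     (\<forall>i<n. v i \<le> (\<Sum>a | a \<in> A \<and> src a = i. v (tgt a) / 2 ^ sig_len (lab a)))"

lemma weight_nonneg: "subinvariant v \<Longrightarrow> weight v i p \<ge> 0"
  by (simp add: weight_def subinvariant_def)

text \<open>Replacing a walk by all its extensions by one edge does not decrease the total weight, hence
  neither does the passage to its first extensions of length at least m. The passage takes finitely
  many steps because only finitely many walks are shorter than m.\<close>

lemma weight_le_crossing:
  assumes v: "subinvariant v" and i: "i < n"
  shows "walk i p j \<Longrightarrow> p \<noteq> [] \<longrightarrow> walk_len (butlast p) < m \<Longrightarrow>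
    weight v i p \<le> sum (weight v i) {q \<in> crossing i m. \<exists>r. q = p @ r}"
proof -
  define Q where "Q p = {q \<in> crossing i m. \<exists>r. q = p @ r}" for p
  have finQ: "finite (Q p)" for p using finite_crossing by (simp add: Q_def)
  define short where "short = {q. (\<exists>j. walk i q j) \<and> walk_len q \<le> m}"
  have "finite short" using finite_walks_len_le by (simp add: short_def)
  then obtain N where N: "\<And>q. q \<in> short \<Longrightarrow> length q \<le> N"
    using finite_nat_set_iff_bounded_le[of "length ` short"] by auto
  have "weight v i p \<le> sum (weight v i) (Q p)"
    if "walk i p j" "p \<noteq> [] \<longrightarrow> walk_len (butlast p) < m" for p j
    using that
  proof (induction "Suc N - length p" arbitrary: p j rule: less_induct)
    case less
    show ?case
    proof (cases "walk_len p \<ge> m")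
      case True
      then have "p \<in> Q p" using less.prems by (auto simp: Q_def crossing_def)
      then show ?thesis using finQ weight_nonneg[OF v] by (intro member_le_sum) auto
    next
      case False
      define E where "E = {a \<in> A. src a = j}"
      have finE: "finite E" using finite_A by (simp add: E_def)
      have "p \<in> short" using False less.prems by (auto simp: short_def)
      then have len: "length p \<le> N" by (rule N)
      have "j < n" using walk_nodes less.prems i by blast
      then have "v j \<le> (\<Sum>a\<in>E. v (tgt a) / 2 ^ sig_len (lab a))"
        using v by (auto simp: subinvariant_def E_def)
      then have "v j / 2 ^ walk_len p \<le> (\<Sum>a\<in>E. v (tgt a) / 2 ^ sig_len (lab a)) / 2 ^ walk_len p"
        by (intro divide_right_mono) auto
      also have "\<dots> = (\<Sum>a\<in>E. weight v i (p @ [a]))"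
        by (simp add: sum_divide_distrib weight_def walk_end_def sig_len_mult power_add mult.commute)
      finally have "weight v i p \<le> (\<Sum>a\<in>E. weight v i (p @ [a]))"
        using walk_end[OF less.prems(1)] by (simp add: weight_def)
      also have "\<dots> \<le> (\<Sum>a\<in>E. sum (weight v i) (Q (p @ [a])))"
      proof (rule sum_mono)
        fix a assume "a \<in> E"
        then have "walk i (p @ [a]) (tgt a)" using less.prems by (auto simp: E_def walk_append)
        then show "weight v i (p @ [a]) \<le> sum (weight v i) (Q (p @ [a]))"
          using len False by (intro less.hyps) auto
      qed
      also have "\<dots> = sum (weight v i) (\<Union>a\<in>E. Q (p @ [a]))"
      proof (intro sum.UNION_disjoint[symmetric] ballI impI)
        fix a b :: edge assume "a \<noteq> b"
        then show "Q (p @ [a]) \<inter> Q (p @ [b]) = {}" by (auto simp: Q_def)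
      qed (use finE finQ in auto)
      also have "\<dots> \<le> sum (weight v i) (Q p)"
        using finQ weight_nonneg[OF v] by (intro sum_mono2) (auto simp: Q_def)
      finally show ?thesis .
    qed
  qed
  then show "walk i p j \<Longrightarrow> p \<noteq> [] \<longrightarrow> walk_len (butlast p) < m \<Longrightarrow>
    weight v i p \<le> sum (weight v i) {q \<in> crossing i m. \<exists>r. q = p @ r}"
    by (simp add: Q_def)
qed

definition crossing_at :: "nat \<Rightarrow> letter list \<Rightarrow> edge list set" where
  "crossing_at i w = {p \<in> crossing i (length w). \<exists>u. word_of (walk_lab p) = w @ u}"

text \<open>The factor in front divides by the fair coin measure of the cylinder of w.\<close>

definition cyl_density :: "(nat \<Rightarrow> real) \<Rightarrow> nat \<Rightarrow> letter list \<Rightarrow> real" where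
  "cyl_density v i w = 2 ^ length w * sum (weight v i) (crossing_at i w)"

lemma finite_crossing_at: "finite (crossing_at i w)"
  using finite_crossing by (simp add: crossing_at_def)

text \<open>Push each crossing walk on to the next level: its extensions stay in the cylinder and split
  between the two halves, and no weight is lost.\<close>

lemma cyl_density_le_mean:
  assumes v: "subinvariant v" and i: "i < n"
  shows "cyl_density v i w \<le> (cyl_density v i (w @ [LetL]) + cyl_density v i (w @ [LetN])) / 2"
proof -
  define m where "m = length w"
  define Q where "Q p = {q \<in> crossing i (Suc m). \<exists>r. q = p @ r}" for p
  have finQ: "finite (Q p)" for p using finite_crossing by (simp add: Q_def)
  have "sum (weight v i) (crossing_at i w) \<le> (\<Sum>p\<in>crossing_at i w. sum (weight v i) (Q p))"
  proof (rule sum_mono)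
    fix p assume "p \<in> crossing_at i w"
    then obtain j where "walk i p j" "p \<noteq> [] \<longrightarrow> walk_len (butlast p) < m"
      by (auto simp: crossing_at_def crossing_def m_def)
    then show "weight v i p \<le> sum (weight v i) (Q p)"
      unfolding Q_def by (intro weight_le_crossing[OF v i]) auto
  qed
  also have "\<dots> = sum (weight v i) (\<Union>p\<in>crossing_at i w. Q p)"
  proof (intro sum.UNION_disjoint[symmetric] ballI impI)
    fix p q assume pq: "p \<in> crossing_at i w" "q \<in> crossing_at i w" "p \<noteq> q"
    have "p = q" if "p @ r = q @ s" for r s
    proof -
      from that consider u where "q = p @ u" | u where "p = q @ u"
        by (auto simp: append_eq_append_conv2)
      then show ?thesis
        using crossing_antichain pq(1,2) unfolding crossing_at_def by cases (metis (no_types, lifting) append_Nil2 mem_Collect_eq)+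
    qed
    then show "Q p \<inter> Q q = {}" using pq(3) by (auto simp: Q_def)
  qed (use finite_crossing_at finQ in auto)
  also have "\<dots> \<le> sum (weight v i) (crossing_at i (w @ [LetL]) \<union> crossing_at i (w @ [LetN]))"
  proof (intro sum_mono2)
    show "(\<Union>p\<in>crossing_at i w. Q p) \<subseteq> crossing_at i (w @ [LetL]) \<union> crossing_at i (w @ [LetN])"
    proof
      fix q assume "q \<in> (\<Union>p\<in>crossing_at i w. Q p)"
      then obtain p r where p: "p \<in> crossing_at i w" and q: "q \<in> crossing i (Suc m)" "q = p @ r"
        by (auto simp: Q_def)
      obtain u where u: "word_of (walk_lab q) = w @ u"
        using p word_of_mult[of "walk_lab p" "walk_lab r"] by (auto simp: crossing_at_def q(2))
      have "walk_len q \<ge> Suc m" using q(1) by (simp add: crossing_def)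
      then have "u \<noteq> []" using u by (auto simp: sig_len_word_of m_def)
      then obtain c u' where cu: "u = c # u'" by (cases u) auto
      have "c \<in> {LetL, LetN}" using set_word_of[of "walk_lab q"] u cu by auto
      then show "q \<in> crossing_at i (w @ [LetL]) \<union> crossing_at i (w @ [LetN])"
        using q(1) u cu by (auto simp: crossing_at_def m_def)
    qed
  qed (use finite_crossing_at weight_nonneg[OF v] in auto)
  also have "\<dots> = sum (weight v i) (crossing_at i (w @ [LetL])) + sum (weight v i) (crossing_at i (w @ [LetN]))"
  proof (intro sum.union_disjoint finite_crossing_at)
    show "crossing_at i (w @ [LetL]) \<inter> crossing_at i (w @ [LetN]) = {}"
      by (auto simp: crossing_at_def)
  qed
  finally have "2 ^ length w * sum (weight v i) (crossing_at i w) \<le> 2 ^ length w *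
      (sum (weight v i) (crossing_at i (w @ [LetL])) + sum (weight v i) (crossing_at i (w @ [LetN])))"
    by (rule mult_left_mono) simp
  then show ?thesis by (simp add: cyl_density_def distrib_left)
qed

text \<open>What a walk adds beyond the level it crosses: the surplus letters, the inversion and the end
  node. There are finitely many possibilities, and by the code property the walk can be recovered
  from its overhang.\<close>

definition overhang :: "nat \<Rightarrow> nat \<Rightarrow> edge list \<Rightarrow> letter list \<times> bool \<times> nat" where
  "overhang i m p = (drop m (word_of (walk_lab p)), flipped (walk_lab p), walk_end i p)"

definition overhangs :: "(letter list \<times> bool \<times> nat) set" where
  "overhangs = {r. set r \<subseteq> {LetL, LetN} \<and> length r \<le> len_bound} \<times> UNIV \<times> {..<n}"

lemma finite_overhangs: "finite overhangs"
  unfolding overhangs_def by (intro finite_cartesian_product finite_lists_length_le) auto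

lemma crossing_at_word:
  "p \<in> crossing_at i w \<Longrightarrow> word_of (walk_lab p) = w @ drop (length w) (word_of (walk_lab p))"
  by (auto simp: crossing_at_def)

lemma inj_on_overhang: "inj_on (overhang i (length w)) (crossing_at i w)"
proof (rule inj_onI)
  fix p q assume p: "p \<in> crossing_at i w" and q: "q \<in> crossing_at i w"
    and eq: "overhang i (length w) p = overhang i (length w) q"
  have lab: "walk_lab p = walk_lab q"
    using crossing_at_word[OF p] crossing_at_word[OF q] eq
    by (intro sig_eqI) (auto simp: overhang_def)
  obtain j where j: "walk i p j" "walk i q j"
    using p q eq walk_end by (fastforce simp: crossing_at_def crossing_def overhang_def)
  have "r = []" if "[] \<in> crossing_at i w" "r \<in> crossing_at i w" for r
    using that by (auto simp: crossing_at_def crossing_def sig_len_one)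
  then show "p = q" using walk_unique[OF j] lab p q by blast
qed

lemma overhang_in_overhangs:
  assumes "i < n" "p \<in> crossing_at i w"
  shows "overhang i (length w) p \<in> overhangs"
proof -
  obtain j where j: "walk i p j" "p \<in> crossing i (length w)"
    using assms by (auto simp: crossing_at_def crossing_def)
  have "length (drop (length w) (word_of (walk_lab p))) \<le> len_bound"
    using crossing_len[OF j(2)] by (simp add: sig_len_word_of)
  then show ?thesis
    using walk_nodes[OF j(1) assms(1)] walk_end[OF j(1)] set_word_of[of "walk_lab p"] set_drop_subset
    by (fastforce simp: overhang_def overhangs_def)
qed

text \<open>The normalised weight of a walk is a function of its overhang, so the density is a sum of one
  function over some set of overhangs.\<close>

lemma finite_cyl_density_values:
  assumes i: "i < n"
  shows "finite (range (cyl_density v i))"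
proof -
  define h where "h = (\<lambda>(r :: letter list, e :: bool, j). v j / 2 ^ length r)"
  have "cyl_density v i w \<in> sum h ` Pow overhangs" for w
  proof -
    have "2 ^ length w * weight v i p = h (overhang i (length w) p)" if p: "p \<in> crossing_at i w" for p
    proof -
      have "walk_len p = length w + length (drop (length w) (word_of (walk_lab p)))"
        using arg_cong[OF crossing_at_word[OF p], of length] by (simp add: sig_len_word_of)
      then show ?thesis by (simp add: weight_def h_def overhang_def power_add)
    qed
    then have "cyl_density v i w = sum h (overhang i (length w) ` crossing_at i w)"
      by (simp add: cyl_density_def sum_distrib_left sum.reindex[OF inj_on_overhang])
    then show ?thesis using overhang_in_overhangs[OF i] by auto
  qed
  then show ?thesis using finite_overhangs by (meson finite_Pow_iff finite_imageI finite_subset image_subsetI)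
qed

lemma longer_prefix: "xs @ ys = us @ vs \<Longrightarrow> length xs \<le> length us \<Longrightarrow> \<exists>zs. us = xs @ zs"
  by (auto simp: append_eq_append_conv2)

text \<open>A maximum principle. At a word where the density attains its maximum, both one-letter extensions
  attain it too, since the maximum is at most their mean. So below that word the density never
  vanishes and walks cross every subcell.\<close>

lemma limit_set_contains_cell:
  assumes v: "subinvariant v" and i: "i < n" and pos: "v i > 0"
  shows "\<exists>w. cell (of_word w) \<subseteq> limit_set i"
proof -
  have "crossing_at i [] = {[]}"
    by (auto simp: crossing_at_def crossing_def)
  then have start: "cyl_density v i [] = v i"
    by (simp add: cyl_density_def weight_def walk_end_def sig_len_one)
  have "Max (range (cyl_density v i)) \<in> range (cyl_density v i)"
    using finite_cyl_density_values[OF i] by (intro Max_in) auto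
  then obtain w where "cyl_density v i w = Max (range (cyl_density v i))" by auto
  then have max: "cyl_density v i u \<le> cyl_density v i w" for u
    using finite_cyl_density_values[OF i] by (simp add: Max_ge)
  have const: "cyl_density v i (w @ u) = cyl_density v i w" if "set u \<subseteq> {LetL, LetN}" for u
    using that
  proof (induction u rule: rev_induct)
    case (snoc c u)
    have "cyl_density v i w \<le> (cyl_density v i (w @ u @ [LetL]) + cyl_density v i (w @ u @ [LetN])) / 2"
      using cyl_density_le_mean[OF v i, of "w @ u"] snoc by simp
    moreover note max[of "w @ u @ [LetL]"] max[of "w @ u @ [LetN]"]
    ultimately have "cyl_density v i (w @ u @ [c]) = cyl_density v i w" if "c = LetL \<or> c = LetN"
      using that by (elim disjE) simp_all
    then show ?case using snoc.prems by auto
  qed simp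
  have "cell (of_word w) \<subseteq> limit_set i"
  proof
    fix x assume x: "x \<in> cell (of_word w)"
    have "\<exists>p j. walk i p j \<and> length p = k \<and> x \<in> cell (walk_lab p)" for k
    proof -
      \<comment> \<open>A walk that crosses this level has more than k edges; without its last edge its word is a
        prefix of \<open>w @ u\<close>, so its cell contains x.\<close>
      obtain u where u: "length u = Suc (len_bound * k)" "set u \<subseteq> {LetL, LetN}"
        "x \<in> cell (of_word (w @ u))"
        using cell_refine[OF x] by blast
      have "cyl_density v i (w @ u) > 0" using const[OF u(2)] max[of "[]"] start pos by linarith
      then have "crossing_at i (w @ u) \<noteq> {}" by (auto simp: cyl_density_def)
      then obtain q z j where q: "q \<in> crossing i (length (w @ u))" "word_of (walk_lab q) = w @ u @ z"
        "walk i q j"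
        by (auto simp: crossing_at_def crossing_def)
      have "len_bound * k < walk_len q" using q(1) u(1) by (simp add: crossing_def)
      also have "\<dots> \<le> len_bound * length q" by (rule walk_len_le[OF q(3)])
      finally have kq: "k < length q" by simp
      then have ne: "q \<noteq> []" by auto
      define p where "p = butlast q"
      have p: "walk i p (src (last q))" "k \<le> length p" "walk_len p < length (w @ u)"
        using walk_butlast[OF q(3) ne] kq q(1) ne by (auto simp: p_def crossing_def)
      obtain y where "word_of (walk_lab q) = word_of (walk_lab p) @ y"
        using word_of_mult[of "walk_lab p"] walk_butlast(3)[OF q(3) ne] p_def by metis
      then have "word_of (walk_lab p) @ y = (w @ u) @ z" using q(2) by simp
      then obtain y' where "w @ u = word_of (walk_lab p) @ y'"
        using longer_prefix p(3) unfolding sig_len_word_of by (metis less_imp_le)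
      then have xp: "x \<in> cell (walk_lab p)"
        using u(3) cell_append_subset cell_word_of by (metis subsetD)
      have "walk_lab p = walk_lab (take k p) * walk_lab (drop k p)"
        by (metis append_take_drop_id walk_lab_simps(3))
      then have "x \<in> cell (walk_lab (take k p))" using xp cell_mult_subset by (metis subsetD)
      moreover have "\<exists>j. walk i (take k p) j"
        using p(1) walk_append[of i "take k p" "drop k p"] by auto
      moreover have "length (take k p) = k" using p(2) by simp
      ultimately show ?thesis by blast
    qed
    then show "x \<in> limit_set i" by (simp add: limit_set_iff)
  qed
  then show ?thesis by blast
qed

section \<open>Images of limit sets under different edges have disjoint interiors\<close>

text \<open>A set of exactly k codings bounds their number from below without any assumption that there are
  finitely many of them. Rational points are left out because they can be end points of two adjacent
  cells of one level.\<close>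

definition full :: "nat \<Rightarrow> nat \<Rightarrow> sig \<Rightarrow> bool" where
  "full k i s \<longleftrightarrow> (\<forall>x \<in> cell s. x \<in> irrational_pts \<longrightarrow>
     (\<exists>S \<subseteq> codings i x. finite S \<and> card S = k))"

lemma crossing_prefix:
  assumes "p \<in> inf_paths A i"
  shows "\<exists>t. prefix p t \<in> crossing i m"
proof -
  define t where "t = (LEAST t. walk_len (prefix p t) \<ge> m)"
  have ge: "walk_len (prefix p t) \<ge> m"
    unfolding t_def using prefix_len_unbounded[OF assms] by (rule LeastI_ex)
  have "walk_len (prefix p t') < m" if "t' < t" for t'
    using that not_less_Least unfolding t_def by (metis not_le)
  then have "prefix p t \<noteq> [] \<longrightarrow> walk_len (butlast (prefix p t)) < m"
    by (cases t) auto
  then show ?thesis using ge walk_prefix[OF assms] by (auto simp: crossing_def)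
qed

text \<open>Distinct codings of one irrational point are separated by their prefixes that cross a
  sufficiently high level, and those prefixes all lie in the cylinder of the unique word of that level
  that expands the point. So their number is at most the number of overhangs.\<close>

lemma card_codings_le:
  assumes i: "i < n" and x: "x \<in> irrational_pts" and S: "S \<subseteq> codings i x" "finite S"
  shows "card S \<le> card overhangs"
proof -
  obtain d where d: "\<And>p q :: nat \<Rightarrow> edge. p \<noteq> q \<Longrightarrow> p (d p q) \<noteq> q (d p q)"
    by (metis ext)
  define D where "D = Suc (\<Sum>(p, q)\<in>S \<times> S. d p q)"
  have dD: "d p q < D" if "p \<in> S" "q \<in> S" for p q
    using member_le_sum[of "(p, q)" "S \<times> S" "\<lambda>(p, q). d p q"] that S(2) by (auto simp: D_def)
  \<comment> \<open>Walks that cross this level have more than D edges, enough to tell the codings in S apart.\<close>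
  define m where "m = Suc (len_bound * D)"
  have "\<forall>p\<in>S. \<exists>t. prefix p t \<in> crossing i m"
    using S crossing_prefix by (auto simp: codings_def)
  then obtain t where t: "\<And>p. p \<in> S \<Longrightarrow> prefix p (t p) \<in> crossing i m" by metis
  have tD: "D \<le> t p" if p: "p \<in> S" for p
  proof -
    obtain j where "walk i (prefix p (t p)) j" "m \<le> walk_len (prefix p (t p))"
      using t[OF p] by (auto simp: crossing_def)
    then have "len_bound * D < len_bound * t p"
      using walk_len_le[of i "prefix p (t p)" j] unfolding m_def prefix_simps(3) by linarith
    then show ?thesis by simp
  qed
  have inj: "inj_on (\<lambda>p. prefix p (t p)) S"
  proof (rule inj_onI, rule ccontr)
    fix p q assume p: "p \<in> S" and q: "q \<in> S" and eq: "prefix p (t p) = prefix q (t q)" and ne: "p \<noteq> q"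
    have "prefix p (t p) ! d p q = p (d p q)" "prefix q (t q) ! d p q = q (d p q)"
      using dD[OF p q] tD[OF p] tD[OF q] by (simp_all add: prefix_def)
    then show False using d[OF ne] eq by simp
  qed
  define w where "w p = take m (word_of (walk_lab (prefix p (t p))))" for p
  have w: "length (w p) = m" "set (w p) \<subseteq> {LetL, LetN}" "x \<in> cell (of_word (w p))"
    "prefix p (t p) \<in> crossing_at i (w p)" if p: "p \<in> S" for p
  proof -
    have split: "word_of (walk_lab (prefix p (t p))) = w p @ drop m (word_of (walk_lab (prefix p (t p))))"
      by (simp add: w_def)
    show len: "length (w p) = m" using t[OF p] by (simp add: w_def crossing_def sig_len_word_of)
    show "set (w p) \<subseteq> {LetL, LetN}"
      using set_word_of set_take_subset unfolding w_def by (meson order_trans)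
    have "x \<in> cell (walk_lab (prefix p (t p)))" using p S by (auto simp: codings_def)
    then have "x \<in> cell (of_word (w p @ drop m (word_of (walk_lab (prefix p (t p))))))"
      using split cell_word_of by metis
    then show "x \<in> cell (of_word (w p))" using cell_append_subset by blast
    show "prefix p (t p) \<in> crossing_at i (w p)"
      using t[OF p] split unfolding crossing_at_def len by blast
  qed
  show ?thesis
  proof (cases "S = {}")
    case False
    then obtain p0 where p0: "p0 \<in> S" by blast
    have "w p = w p0" if "p \<in> S" for p
      using irrational_word_unique[OF x w(3)[OF that] w(3)[OF p0]] w that p0 by simp
    then have sub: "(\<lambda>p. prefix p (t p)) ` S \<subseteq> crossing_at i (w p0)" using w(4) by auto
    have "card S = card ((\<lambda>p. prefix p (t p)) ` S)" using inj by (simp add: card_image)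
    also have "\<dots> \<le> card (crossing_at i (w p0))" using sub finite_crossing_at by (rule card_mono[rotated])
    also have "\<dots> = card (overhang i (length (w p0)) ` crossing_at i (w p0))"
      using inj_on_overhang by (simp add: card_image)
    also have "\<dots> \<le> card overhangs"
      using overhang_in_overhangs[OF i] finite_overhangs by (intro card_mono) auto
    finally show ?thesis .
  qed simp
qed

lemma case_nat_inj: "inj (case_nat a :: (nat \<Rightarrow> edge) \<Rightarrow> nat \<Rightarrow> edge)"
  by (rule injI, rule ext) (metis nat.case(2))

lemma full_Cons:
  assumes a: "a \<in> A" and f: "full k (tgt a) s"
  shows "full k (src a) (lab a * s)"
  unfolding full_def
proof (intro ballI impI)
  fix x assume "x \<in> cell (lab a * s)" "x \<in> irrational_pts"
  then obtain y where y: "x = sig_act (lab a) y" "y \<in> cell s" "y \<in> irrational_pts"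
    using irrational_sig_act by (auto simp: cell_mult)
  then obtain S where S: "S \<subseteq> codings (tgt a) y" "finite S" "card S = k"
    using f by (auto simp: full_def)
  have "case_nat a ` S \<subseteq> codings (src a) x" using S(1) codings_Cons[OF a] y(1) by blast
  moreover have "card (case_nat a ` S) = k"
    using S(3) card_image[OF inj_on_subset[OF case_nat_inj subset_UNIV]] by metis
  ultimately show "\<exists>S\<subseteq>codings (src a) x. finite S \<and> card S = k" using S(2) by blast
qed

lemma full_walk: "walk i p j \<Longrightarrow> full k j s \<Longrightarrow> full k i (walk_lab p * s)"
proof (induction p arbitrary: i)
  case (Cons a p)
  then show ?case using full_Cons[of a k "walk_lab p * s"] by (auto simp: mult.assoc)
qed simp

text \<open>A cell over which every irrational point has the largest guaranteed number of codings can be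
  moved by a walk into any prescribed place of a limit set. If it were moved into the common part of the
  images under two edges a and b, those codings would all begin with a, and a further one would begin
  with b.\<close>

lemma edge_images_disjoint:
  assumes connected: "\<And>i j. i < n \<Longrightarrow> j < n \<Longrightarrow> \<exists>p. walk i p j"
    and a: "a \<in> A" and b: "b \<in> A" "src b = src a" and ne: "a \<noteq> b"
    and V: "openin p1_top V" "V \<subseteq> sig_act (lab a) ` limit_set (tgt a)"
      "V \<subseteq> sig_act (lab b) ` limit_set (tgt b)"
  shows "V = {}"
proof (rule ccontr)
  assume "V \<noteq> {}"
  then obtain y where y: "y \<in> limit_set (tgt a)" "sig_act (lab a) y \<in> V" using V(2) by blast
  have bounded: "k \<le> card overhangs" if "i < n" "full k i s" for k i s
    using irrational_cell_nonempty[of s] that card_codings_le unfolding full_def by metis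
  define P where "P k \<longleftrightarrow> (\<exists>i<n. \<exists>s. full k i s)" for k
  have "P 0" using edge_nodes[OF a] unfolding P_def full_def by (metis card.empty empty_subsetI finite.emptyI)
  define M where "M = (GREATEST k. P k)"
  have bP: "\<forall>k. P k \<longrightarrow> k \<le> card overhangs" using bounded by (auto simp: P_def)
  have "P M" unfolding M_def using GreatestI_nat[of P 0] \<open>P 0\<close> bP by blast
  have greatest: "k \<le> M" if "P k" for k
    unfolding M_def using Greatest_le_nat[of P k] that bP by blast
  obtain i s where node: "i < n" "full M i s" using \<open>P M\<close> by (auto simp: P_def)
  define U where "U = sig_act (lab a) -` V"
  have U: "openin p1_top U"
    unfolding U_def using V(1) by (intro openin_mobius_vimage det_Proj_nonzero)
  obtain p j where p: "walk (tgt a) p j" "cell (walk_lab p) \<subseteq> U"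
    using limit_set_small_cell[OF y(1) U] y(2) unfolding U_def by blast
  obtain r where r: "walk j r i"
    using connected walk_nodes[OF p(1)] edge_nodes[OF a] node(1) by blast
  define s' where "s' = walk_lab (p @ r) * s"
  have "walk (tgt a) (p @ r) i" using p(1) r by (auto simp: walk_append)
  then have s': "full M (tgt a) s'" unfolding s'_def using node(2) by (rule full_walk)
  have "cell s' \<subseteq> U" using p(2) cell_mult_subset by (fastforce simp: s'_def mult.assoc)
  have "full (Suc M) (src a) (lab a * s')"
    unfolding full_def
  proof (intro ballI impI)
    fix x assume "x \<in> cell (lab a * s')" "x \<in> irrational_pts"
    then obtain z where z: "x = sig_act (lab a) z" "z \<in> cell s'" "z \<in> irrational_pts"
      using irrational_sig_act by (auto simp: cell_mult)
    obtain S where S: "S \<subseteq> codings (tgt a) z" "finite S" "card S = M"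
      using s' z by (auto simp: full_def)
    have 1: "case_nat a ` S \<subseteq> codings (src a) x" using S(1) codings_Cons[OF a] z(1) by blast
    have "x \<in> V" using z \<open>cell s' \<subseteq> U\<close> by (auto simp: U_def)
    then obtain z' where z': "x = sig_act (lab b) z'" "z' \<in> limit_set (tgt b)"
      using V(3) by blast
    then obtain q where "q \<in> codings (tgt b) z'" by (auto simp: limit_set_def)
    then have 2: "case_nat b q \<in> codings (src a) x" using codings_Cons[OF b(1)] b(2) z'(1) by metis
    have "case_nat b q \<notin> case_nat a ` S"
      using ne by (auto dest: fun_cong[where x = 0])
    moreover have "card (case_nat a ` S) = M"
      using S(3) card_image[OF inj_on_subset[OF case_nat_inj subset_UNIV]] by metis
    ultimately have "card (insert (case_nat b q) (case_nat a ` S)) = Suc M" using S(2) by simp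
    then show "\<exists>S\<subseteq>codings (src a) x. finite S \<and> card S = Suc M"
      using 1 2 S(2) by (metis finite_imageI finite_insert insert_subset)
  qed
  then have "P (Suc M)" using edge_nodes[OF a] by (auto simp: P_def)
  then show False using greatest by fastforce
qed

section \<open>The topology of the limit sets\<close>

text \<open>A walk from i to the node i0 maps the cell inside the limit set of i0 into the limit set of i.\<close>

lemma limit_set_interior_nonempty:
  assumes connected: "\<And>i j. i < n \<Longrightarrow> j < n \<Longrightarrow> \<exists>p. walk i p j"
    and v: "subinvariant v" "i0 < n" "v i0 > 0" and i: "i < n"
  shows "p1_top interior_of limit_set i \<noteq> {}"
proof -
  obtain w where w: "cell (of_word w) \<subseteq> limit_set i0" using limit_set_contains_cell[OF v] by blast
  obtain p where p: "walk i p i0" using connected i v(2) by blast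
  have "cell (walk_lab p * of_word w) \<subseteq> limit_set i"
    using limit_set_walk[OF p] w unfolding cell_mult by blast
  moreover obtain U where "openin p1_top U" "U \<noteq> {}" "U \<subseteq> cell (walk_lab p * of_word w)"
    using cell_interior by blast
  ultimately have "openin p1_top U" "U \<noteq> {}" "U \<subseteq> limit_set i" by auto
  moreover from this have "U \<subseteq> p1_top interior_of limit_set i" by (intro interior_of_maximal)
  ultimately show ?thesis by auto
qed

text \<open>Any neighbourhood of a point of a limit set contains the image of an entire limit set under a
  prefix of a coding of that point, and this image has interior.\<close>

lemma limit_set_regular:
  assumes nonempty: "\<And>i. i < n \<Longrightarrow> p1_top interior_of limit_set i \<noteq> {}" and i: "i < n"
  shows "limit_set i = p1_top closure_of (p1_top interior_of limit_set i)"
proof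
  show "p1_top closure_of (p1_top interior_of limit_set i) \<subseteq> limit_set i"
    by (intro closure_of_minimal interior_of_subset closedin_limit_set)
  show "limit_set i \<subseteq> p1_top closure_of (p1_top interior_of limit_set i)"
  proof
    fix x assume x: "x \<in> limit_set i"
    have "\<exists>y. y \<in> p1_top interior_of limit_set i \<and> y \<in> U" if U: "openin p1_top U" "x \<in> U" for U
    proof -
      obtain p j where p: "walk i p j" "cell (walk_lab p) \<subseteq> U"
        using limit_set_small_cell[OF x U] by blast
      define V where "V = sig_act (walk_lab p) ` (p1_top interior_of limit_set j)"
      have "V \<noteq> {}" using nonempty walk_nodes[OF p(1) i] by (simp add: V_def)
      moreover have "openin p1_top V" unfolding V_def by (intro openin_sig_act openin_interior_of)
      moreover have "V \<subseteq> sig_act (walk_lab p) ` limit_set j"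
        unfolding V_def by (intro image_mono interior_of_subset)
      then have "V \<subseteq> limit_set i" using limit_set_walk[OF p(1)] by (rule order_trans)
      moreover have "V \<subseteq> sig_act (walk_lab p) ` nonneg_p1"
        using \<open>V \<subseteq> sig_act (walk_lab p) ` limit_set j\<close> image_mono[OF limit_set_subset]
        by (rule order_trans)
      then have "V \<subseteq> U" using p(2) unfolding cell_def by (rule order_trans)
      moreover from calculation have "V \<subseteq> p1_top interior_of limit_set i"
        by (intro interior_of_maximal)
      ultimately show ?thesis by blast
    qed
    then show "x \<in> p1_top closure_of (p1_top interior_of limit_set i)"
      by (simp add: in_closure_of)
  qed
qed

end

section \<open>Subinvariant vectors of an abstract continued fraction\<close>

text \<open>The moduli of the entries of an eigenvector for an eigenvalue of modulus one form a subinvariant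
  vector, by the triangle inequality.\<close>

lemma (in finite_code) spectral_radius_one_imp_subinvariant:
  assumes n: "n \<ge> 1" and sr: "spectral_radius (code_matrix n A) = 1"
  shows "\<exists>v. subinvariant v \<and> (\<exists>i<n. v i > 0)"
proof -
  define G where "G = code_matrix n A"
  have G: "G \<in> carrier_mat n n" by (simp add: G_def code_matrix_def)
  obtain l where l: "l \<in> spectrum G" "norm l = 1"
    using spectral_radius_mem_max(1)[OF G] n sr by (auto simp: G_def)
  then obtain x where x: "x \<in> carrier_vec n" "x \<noteq> 0\<^sub>v n" "G *\<^sub>v x = l \<cdot>\<^sub>v x"
    using G by (auto simp: spectrum_def eigenvalue_def eigenvector_def)
  define v where "v i = (if i < n then norm (vec_index x i) else 0)" for i
  have "v i \<le> (\<Sum>a | a \<in> A \<and> src a = i. v (tgt a) / 2 ^ sig_len (lab a))" if i: "i < n" for i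
  proof -
    have "l * vec_index x i = vec_index (G *\<^sub>v x) i" using x i by simp
    also have "\<dots> = (\<Sum>j<n. G $$ (i, j) * vec_index x j)"
      using G x(1) i by (simp add: scalar_prod_def lessThan_atLeast0)
    finally have e: "l * vec_index x i = (\<Sum>j<n. G $$ (i, j) * vec_index x j)" .
    have "v i = norm (l * vec_index x i)" using l(2) i by (simp add: v_def norm_mult)
    also have "\<dots> \<le> (\<Sum>j<n. norm (G $$ (i, j) * vec_index x j))" unfolding e by (rule norm_sum)
    also have "\<dots> \<le> (\<Sum>j<n. \<Sum>a\<in>edges_between A i j. v (tgt a) / 2 ^ sig_len (lab a))"
    proof (rule sum_mono)
      fix j assume j: "j \<in> {..<n}"
      have "G $$ (i, j) = (\<Sum>a\<in>edges_between A i j. 1 / 2 ^ sig_len (lab a))"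
        using i j by (simp add: G_def code_matrix_def)
      then have "norm (G $$ (i, j)) \<le> (\<Sum>a\<in>edges_between A i j. norm (1 / 2 ^ sig_len (lab a) :: complex))"
        by (simp only: norm_sum)
      then have "norm (G $$ (i, j) * vec_index x j) \<le> (\<Sum>a\<in>edges_between A i j. 1 / 2 ^ sig_len (lab a)) * v j"
        using j by (simp add: norm_mult v_def norm_divide norm_power mult_right_mono)
      also have "\<dots> = (\<Sum>a\<in>edges_between A i j. v (tgt a) / 2 ^ sig_len (lab a))"
        by (simp add: sum_distrib_right edges_between_def)
      finally show "norm (G $$ (i, j) * vec_index x j) \<le> (\<Sum>a\<in>edges_between A i j. v (tgt a) / 2 ^ sig_len (lab a))" .
    qed
    also have "\<dots> = (\<Sum>j<n. \<Sum>a\<in>{a \<in> {a \<in> A. src a = i}. tgt a = j}. v (tgt a) / 2 ^ sig_len (lab a))"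
      by (intro sum.cong) (auto simp: edges_between_def)
    also have "\<dots> = (\<Sum>a\<in>{a \<in> A. src a = i}. v (tgt a) / 2 ^ sig_len (lab a))"
      using finite_A edge_nodes by (intro sum.group) auto
    finally show ?thesis .
  qed
  then have "subinvariant v" by (auto simp: subinvariant_def v_def)
  moreover have "\<exists>i<n. v i > 0"
  proof (rule ccontr)
    assume "\<not> ?thesis"
    then have "vec_index x i = 0" if "i < n" for i using that by (auto simp: v_def)
    then have "x = 0\<^sub>v n" using x(1) by (intro eq_vecI) auto
    then show False using x(2) by simp
  qed
  ultimately show ?thesis by blast
qed

lemma (in finite_code) strongly_connected_imp_walk:
  assumes "strongly_connected (code_graph n A)" "i < n" "j < n"
  shows "\<exists>p. walk i p j"
proof -
  have "(i, j) \<in> rtrancl_on {..<n} (arcs_ends (code_graph n A))"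
    using assms by (auto simp: strongly_connected_def reachable_def code_graph_def)
  then show ?thesis
  proof (induction rule: rtrancl_on_induct)
    case base
    show ?case by (intro exI[of _ "[]"]) simp
  next
    case (step y z)
    then obtain p a where "walk i p y" "a \<in> A" "src a = y" "tgt a = z"
      by (auto simp: arcs_ends_def arc_to_ends_def code_graph_def)
    then show ?case by (intro exI[of _ "p @ [a]"]) (auto simp: walk_append)
  qed
qed

section \<open>From the positive half-line to arbitrary unimodular intervals\<close>

lemma matrix_inv_left_int:
  assumes "Determinants.det (M :: int^2^2) = 1"
  shows "matrix_inv M ** M = Finite_Cartesian_Product.mat 1"
proof -
  have "\<exists>N. M ** N = Finite_Cartesian_Product.mat 1 \<and> N ** M = Finite_Cartesian_Product.mat 1"
    using assms by (metis det_square_one_imp_inverse power_one)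
  from someI_ex[OF this] show ?thesis unfolding matrix_inv_def by blast
qed

lemma mobius_edge_mat:
  assumes "Determinants.det (I (tgt a)) = 1"
  shows "mobius (edge_mat I a) ` mobius (I (tgt a)) ` S = mobius (I (src a)) ` sig_act (lab a) ` S"
proof -
  have "edge_mat I a ** I (tgt a) = I (src a) ** Proj (lab a)"
    by (simp only: edge_mat_def matrix_mul_assoc[symmetric] matrix_inv_left_int[of "I (tgt a)", OF assms]
        matrix_mul_rid)
  then show ?thesis
    using assms by (simp add: mobius_image_mult[symmetric] det_Proj_nonzero)
qed

text \<open>The matrices of the intervals telescope along a walk, so the system for given intervals is
  conjugate, node by node, to the one whose intervals are all the positive half-line.\<close>

lemma (in finite_code) attractor_eq_limit_set:
  assumes det: "\<And>i. i < n \<Longrightarrow> Determinants.det (I i) = 1" and i: "i < n"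
  shows "attractor A I i = mobius (I i) ` limit_set i"
proof -
  have inj: "inj (mobius (I i))" using bij_mobius[of "I i"] det[OF i] by (simp add: bij_def)
  have tele: "path_mat I p t ** I (src (p t)) = I i ** Proj (walk_lab (prefix p t))"
    if p: "p \<in> inf_paths A i" for p t
  proof (induction t)
    case 0
    have "src (p 0) = i" using p by (simp add: inf_paths_def)
    then show ?case by (simp only: path_mat.simps prefix_simps walk_lab_simps Proj_one matrix_mul_lid matrix_mul_rid)
  next
    case (Suc t)
    have e: "src (p (Suc t)) = tgt (p t)" "Determinants.det (I (tgt (p t))) = 1"
      using p det edge_nodes by (auto simp: inf_paths_def)
    have "path_mat I p (Suc t) ** I (src (p (Suc t))) =
        (path_mat I p t ** I (src (p t))) ** Proj (lab (p t)) ** (matrix_inv (I (tgt (p t))) ** I (tgt (p t)))"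
      by (simp only: path_mat.simps edge_mat_def e(1) matrix_mul_assoc)
    also have "\<dots> = I i ** (Proj (walk_lab (prefix p t)) ** Proj (lab (p t)))"
      by (simp only: Suc matrix_inv_left_int[OF e(2)] matrix_mul_rid matrix_mul_assoc)
    also have "\<dots> = I i ** Proj (walk_lab (prefix p (Suc t)))"
      by (simp add: Proj_mult)
    finally show ?case .
  qed
  have img: "mobius (path_mat I p t) ` uni_interval (I (src (p t)))
      = mobius (I i) ` cell (walk_lab (prefix p t))" if p: "p \<in> inf_paths A i" for p t
  proof -
    have "Determinants.det (I (src (p t))) = 1" using p det edge_nodes by (auto simp: inf_paths_def)
    then show ?thesis
      by (simp add: uni_interval_nonneg cell_def mobius_image_mult[symmetric] det_Proj_nonzero tele[OF p])
  qed
  have pt: "path_point I p = mobius (I i) x" if x: "p \<in> codings i x" for p x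
  proof -
    have p: "p \<in> inf_paths A i" using x by (simp add: codings_def)
    show ?thesis
      unfolding path_point_def img[OF p]
    proof (rule the_equality)
      show "mobius (I i) x \<in> (\<Inter>t. mobius (I i) ` cell (walk_lab (prefix p t)))"
        using x by (auto simp: codings_def)
    next
      fix y assume y: "y \<in> (\<Inter>t. mobius (I i) ` cell (walk_lab (prefix p t)))"
      then obtain z where z: "y = mobius (I i) z" by blast
      then have "p \<in> codings i z"
        using y p inj by (auto simp: codings_def inj_image_mem_iff)
      then show "y = mobius (I i) x" using codings_unique x z by blast
    qed
  qed
  show ?thesis
  proof
    show "attractor A I i \<subseteq> mobius (I i) ` limit_set i"
    proof
      fix y assume "y \<in> attractor A I i"
      then obtain p where p: "p \<in> inf_paths A i" "y = path_point I p" by (auto simp: attractor_def)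
      obtain x where "p \<in> codings i x" using codings_exist[of p] p(1) by (auto simp: codings_def)
      then show "y \<in> mobius (I i) ` limit_set i" using pt p(2) by (auto simp: limit_set_def)
    qed
    show "mobius (I i) ` limit_set i \<subseteq> attractor A I i"
    proof
      fix y assume "y \<in> mobius (I i) ` limit_set i"
      then obtain x p where "y = mobius (I i) x" "p \<in> codings i x" by (auto simp: limit_set_def)
      moreover from this have "p \<in> inf_paths A i" by (simp add: codings_def)
      ultimately show "y \<in> attractor A I i" using pt unfolding attractor_def by (metis imageI)
    qed
  qed
qed

theorem theorem2p8:
  fixes n :: nat and A :: "edge set" and I :: "nat \<Rightarrow> int^2^2"
  assumes "n \<ge> 1"
    and "abstract_cf n A"
    and "\<And>i. i < n \<Longrightarrow> Determinants.det (I i) = 1"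
  shows "open_set_condition n A I \<and>
    (\<forall>i<n. attractor A I i = p1_top closure_of (p1_top interior_of (attractor A I i))) \<and>
    (\<forall>i<n. \<exists>x y. x \<noteq> y \<and> p1_interval x y \<subseteq> attractor A I i) \<and>
    osc_witness n A I (\<lambda>i. p1_top interior_of (attractor A I i))"
proof -
  interpret finite_code n A
    using assms(2) by unfold_locales (auto simp: abstract_cf_def)
  have connected: "\<exists>p. walk i p j" if "i < n" "j < n" for i j
    using assms(2) that by (intro strongly_connected_imp_walk) (auto simp: abstract_cf_def)
  obtain v i0 where v: "subinvariant v" "i0 < n" "v i0 > 0"
    using spectral_radius_one_imp_subinvariant[OF assms(1)] assms(2) by (auto simp: abstract_cf_def)
  have nonempty: "p1_top interior_of limit_set i \<noteq> {}" if "i < n" for i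
    using limit_set_interior_nonempty[OF connected v that] .
  have homeo: "homeomorphic_map p1_top p1_top (mobius (I i))" if "i < n" for i
    using assms(3)[OF that] by (intro homeomorphic_map_mobius) simp
  note attr = attractor_eq_limit_set[OF assms(3)]
  have int: "p1_top interior_of attractor A I i = mobius (I i) ` (p1_top interior_of limit_set i)"
    if "i < n" for i
    using homeomorphic_map_interior_of[OF homeo[OF that]] by (simp add: attr that)
  have regular: "attractor A I i = p1_top closure_of (p1_top interior_of (attractor A I i))"
    if i: "i < n" for i
  proof -
    have "p1_top closure_of (p1_top interior_of (attractor A I i))
        = mobius (I i) ` (p1_top closure_of (p1_top interior_of limit_set i))"
      using homeomorphic_map_closure_of[OF homeo[OF i]] by (simp add: int i)
    then show ?thesis using limit_set_regular[OF nonempty i] attr[OF _ i] by simp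
  qed
  have intervals: "\<exists>x y. x \<noteq> y \<and> p1_interval x y \<subseteq> attractor A I i" if i: "i < n" for i
  proof -
    have ne: "p1_top interior_of (attractor A I i) \<noteq> {}" using nonempty i by (simp add: int)
    obtain s t :: real where st: "s < t" "Some ` {s..t} \<subseteq> p1_top interior_of (attractor A I i)"
      using nonempty_open_contains_interval[OF openin_interior_of ne] by blast
    then have "p1_interval (Some s) (Some t) \<subseteq> attractor A I i"
      using interior_of_subset[of p1_top "attractor A I i"] by auto
    then show ?thesis using st(1) by (intro exI[of _ "Some s"] exI[of _ "Some t"]) auto
  qed
  have osc: "osc_witness n A I (\<lambda>i. p1_top interior_of (attractor A I i))"
    unfolding osc_witness_def
  proof (intro conjI allI impI ballI)
    fix i assume i: "i < n"
    show "p1_top interior_of (attractor A I i) \<noteq> {}" using nonempty i by (simp add: int)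
    show "p1_top interior_of (attractor A I i) \<subseteq> uni_interval (I i)"
      using interior_of_subset[of p1_top "limit_set i"] limit_set_subset[of i]
      by (auto simp: int i uni_interval_nonneg)
    show "openin p1_top (p1_top interior_of (attractor A I i))" by (rule openin_interior_of)
    have img: "mobius (edge_mat I a) ` (p1_top interior_of (attractor A I (tgt a)))
        = mobius (I i) ` sig_act (lab a) ` (p1_top interior_of limit_set (tgt a))"
      if "a \<in> A" "src a = i" for a
      using edge_nodes[OF that(1)] that assms(3) mobius_edge_mat[of I a] by (simp add: int)
    show "mobius (edge_mat I a) ` (p1_top interior_of (attractor A I (tgt a)))
        \<subseteq> p1_top interior_of (attractor A I i)" if a: "a \<in> A" "src a = i" for a
    proof -
      have "sig_act (lab a) ` (p1_top interior_of limit_set (tgt a)) \<subseteq> p1_top interior_of limit_set i"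
        using limit_set_edge[OF a(1)] a(2) interior_of_subset[of p1_top "limit_set (tgt a)"]
        by (intro interior_of_maximal openin_sig_act openin_interior_of) blast
      then show ?thesis unfolding img[OF a] int[OF i] by (rule image_mono)
    qed
    show "disjoint_family_on (\<lambda>a. mobius (edge_mat I a) ` (p1_top interior_of (attractor A I (tgt a))))
        {a \<in> A. src a = i}"
      unfolding disjoint_family_on_def
    proof (intro ballI impI)
      fix a b assume a: "a \<in> {a \<in> A. src a = i}" and b: "b \<in> {a \<in> A. src a = i}" and ne: "a \<noteq> b"
      define V where "V = sig_act (lab a) ` (p1_top interior_of limit_set (tgt a))
        \<inter> sig_act (lab b) ` (p1_top interior_of limit_set (tgt b))"
      have "V = {}"
      proof (rule edge_images_disjoint[OF connected])
        show "openin p1_top V"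
          unfolding V_def by (intro openin_Int openin_sig_act openin_interior_of)
        show "V \<subseteq> sig_act (lab a) ` limit_set (tgt a)" "V \<subseteq> sig_act (lab b) ` limit_set (tgt b)"
          unfolding V_def
          by (rule order_trans[OF Int_lower1 image_mono[OF interior_of_subset]],
              rule order_trans[OF Int_lower2 image_mono[OF interior_of_subset]])
      qed (use a b ne in auto)
      moreover have "inj (mobius (I i))"
        using bij_mobius[of "I i"] assms(3)[OF i] by (simp add: bij_def)
      moreover have "a \<in> A" "src a = i" "b \<in> A" "src b = i" using a b by auto
      ultimately show "mobius (edge_mat I a) ` (p1_top interior_of (attractor A I (tgt a)))
          \<inter> mobius (edge_mat I b) ` (p1_top interior_of (attractor A I (tgt b))) = {}"
        by (simp add: img image_Int[symmetric] V_def)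
    qed
  qed
  then have "open_set_condition n A I" unfolding open_set_condition_def by blast
  then show ?thesis using regular intervals osc by blast
qed

end
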